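(* Let $n\geq 48$ be an integer. Among all planar graphs of order $n$ that contain a dominating vertex, the graph $P_{2}\bigtriangledown P_{n-2}$ attains the maximum spectral radius; that is, for every planar graph $G$ of order $n$ containing a dominating vertex, $\rho(G)\le \rho(P_{2}\bigtriangledown P_{n-2})$.
   Context: All graphs are finite, simple and undirected. $\rho(G)$ is the largest eigenvalue of the adjacency matrix of $G$. A dominating vertex of a graph of order $n$ is a vertex of degree $n-1$. $P_k$ denotes the path on $k$ vertices. For disjoint graphs $H,G$, the join $H\bigtriangledown G$ is obtained from the disjoint union $H\cup G$ by adding all edges $uv$ with $u\in V(H)$, $v\in V(G)$. *)

theory Defs
  imports
    "HOL-Analysis.Path_Connected"
    "Jordan_Normal_Form.Char_Poly"
    "Graph_Theory.Pair_Digraph"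
begin

text \<open>
  Finite simple undirected graphs are the digraphs satisfying \<^locale>\<open>pair_graph\<close>: finite,
  loop-free, with a symmetric arc relation. An undirected edge \<open>{u, v}\<close> is the pair of arcs
  \<open>(u, v)\<close>, \<open>(v, u)\<close>, so the degree of a vertex is its out-degree.
\<close>

definition dominating_vertex :: "'a pair_pre_digraph \<Rightarrow> 'a \<Rightarrow> bool" where
  "dominating_vertex G v \<longleftrightarrow> v \<in> pverts G \<and> out_degree (with_proj G) v = card (pverts G) - 1"

definition path_graph :: "nat \<Rightarrow> nat pair_pre_digraph" where
  "path_graph k = \<lparr> pverts = {..<k},
     parcs = {(i, j). i < k \<and> j < k \<and> (j = Suc i \<or> i = Suc j)} \<rparr>"

definition graph_join :: "'a pair_pre_digraph \<Rightarrow> 'b pair_pre_digraph \<Rightarrow> ('a + 'b) pair_pre_digraph" where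
  "graph_join H G = \<lparr> pverts = pverts H <+> pverts G,
     parcs = {(Inl u, Inl v) | u v. (u, v) \<in> parcs H} \<union> {(Inr u, Inr v) | u v. (u, v) \<in> parcs G}
       \<union> {(Inl u, Inr v) | u v. u \<in> pverts H \<and> v \<in> pverts G}
       \<union> {(Inr v, Inl u) | u v. u \<in> pverts H \<and> v \<in> pverts G} \<rparr>"

text \<open>
  A drawing in the plane places the vertices at distinct points and draws each undirected edge
  \<open>{u, v}\<close> as a simple arc between the points of \<open>u\<close> and \<open>v\<close>; an arc meets no vertex other than
  its ends, and two distinct arcs meet at most in the points of common end vertices.
  Since \<open>c\<close> is indexed by unordered edges, the direction in which an arc is traversed is irrelevant.
\<close>

definition plane_drawing :: "'a pair_pre_digraph \<Rightarrow> ('a \<Rightarrow> complex) \<Rightarrow> ('a set \<Rightarrow> real \<Rightarrow> complex) \<Rightarrow> bool" where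
  "plane_drawing G p c \<longleftrightarrow>
     inj_on p (pverts G) \<and>
     (\<forall>(u, v) \<in> parcs G.
        Path_Connected.arc (c {u, v}) \<and>
        {pathstart (c {u, v}), pathfinish (c {u, v})} = {p u, p v} \<and>
        path_image (c {u, v}) \<inter> p ` pverts G \<subseteq> {p u, p v}) \<and>
     (\<forall>(u, v) \<in> parcs G. \<forall>(x, y) \<in> parcs G. {u, v} \<noteq> {x, y} \<longrightarrow>
        path_image (c {u, v}) \<inter> path_image (c {x, y}) \<subseteq> p ` ({u, v} \<inter> {x, y}))"

definition planar :: "'a pair_pre_digraph \<Rightarrow> bool" where
  "planar G \<longleftrightarrow> (\<exists>p c. plane_drawing G p c)"

definition vertex_enum :: "'a pair_pre_digraph \<Rightarrow> 'a list" where
  "vertex_enum G = (SOME vs. distinct vs \<and> set vs = pverts G)"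

definition adjacency_matrix :: "'a pair_pre_digraph \<Rightarrow> real mat" where
  "adjacency_matrix G = Matrix.mat (card (pverts G)) (card (pverts G))
     (\<lambda>(i, j). if (vertex_enum G ! i, vertex_enum G ! j) \<in> parcs G then 1 else 0)"

text \<open>
  The eigenvalues do not depend on the chosen enumeration of the vertices. As the adjacency matrix
  of a graph is real symmetric, its real eigenvalues are all its eigenvalues, so for a nonempty
  finite graph the maximum is over a nonempty finite set.
\<close>

definition graph_spectral_radius :: "'a pair_pre_digraph \<Rightarrow> real" where
  "graph_spectral_radius G = Max {k. eigenvalue (adjacency_matrix G) k}"

definition planar_with_dominating_vertex :: "nat \<Rightarrow> 'a pair_pre_digraph \<Rightarrow> bool" where
  "planar_with_dominating_vertex n G \<longleftrightarrow>
     pair_graph G \<and> card (pverts G) = n \<and> planar G \<and> (\<exists>v. dominating_vertex G v)"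

end

(*
  Let v dominate G and put H = G - v.  Every edge ab of H closes up with the apex v to a Jordan
  curve v-a-b, and every other vertex of H lies on one of its two sides.  Since an edge of H
  avoiding a, b stays on one side, these sides carry all of the planarity that is needed:
  four internally disjoint arcs from v to w (the edge and three paths v-z-w) must separate each
  other, so two vertices of H have at most two common neighbours, the neighbourhood of a vertex u
  of H induces a linear forest, and every set of vertices outside the closed neighbourhood of u
  can be peeled off by removing vertices with at most two remaining neighbours.

  Let x be the Perron vector of G with x(v) = 1 and u a maximum of x on H.  Counting walks of
  length two shows that either the spectral radius is smaller than that of the extremal graph, or
  x is at most x(u)/2 on H - u.  In the latter case every edge of H that meets the vertices not
  adjacent to u can be charged to such a vertex w, two edges per w, each costing at most
  x(w) x(u)/2; so joining all these w to u, and completing the linear forest to a Hamiltonian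
  path, does not decrease the quadratic form.
*)
theory Submission
  imports Defs "HOL-Analysis.Jordan_Curve" "HOL-Analysis.Function_Topology"
begin

section \<open>Arcs and theta curves in the plane\<close>

text \<open>Suppose \<rho>(G) = \<rho> exceeds the spectral radius r of the extremal graph. The two
  are compared through s^2 - 3s, the form in which a two-valued test vector bounds r from below: r^2
  - 3r >= 2k - 5/2 with k = n - 2. The right side exceeds 88 = 11 * 8 exactly when n >= 48, and then
  \<rho> >= 11. The dichotomy behind the factor 1/2 is quantitative. Walk counting forces a vertex
  of H with entry s to have degree at least about (11s - 3) / (8(1 + s)) times \<rho>^2 - 3\<rho>.
  If the largest entry is close to 1 and the second exceeds half of it, the two degrees add up to
  more than |H| + 2, although two vertices share at most two neighbours. If the largest entry is
  moderate, summing the eigenvalue equations over H leaves too little weight. Planarity is used only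
  by comparing sides of triangles through the apex; faces and Euler's formula do not occur.
  Perron-Frobenius is not invoked either: the maximizer of the Rayleigh quotient is nonnegative, and
  domination by v makes its entry at v positive.\<close>

definition arc_between :: "complex \<Rightarrow> complex \<Rightarrow> complex set \<Rightarrow> bool" where
  "arc_between a b P \<longleftrightarrow> (\<exists>g. Path_Connected.arc g \<and> pathstart g = a \<and> pathfinish g = b \<and> path_image g = P)"

lemma arc_betweenE:
  assumes "arc_between a b P"
  obtains g where "Path_Connected.arc g" "pathstart g = a" "pathfinish g = b" "path_image g = P"
  using assms unfolding arc_between_def by blast

lemma arc_between_sym: "arc_between a b P \<Longrightarrow> arc_between b a P"
  unfolding arc_between_def
  by (metis arc_reversepath path_image_reversepath pathfinish_reversepath pathstart_reversepath)

lemma arc_between_join: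
  assumes "arc_between a b P" "arc_between b c Q" "P \<inter> Q \<subseteq> {b}"
  shows "arc_between a c (P \<union> Q)"
  using assms unfolding arc_between_def
  by (metis arc_join path_image_join pathfinish_join pathstart_join)

lemma arc_between_ends: "arc_between a b P \<Longrightarrow> a \<in> P \<and> b \<in> P \<and> a \<noteq> b"
  unfolding arc_between_def using arc_distinct_ends pathstart_in_path_image pathfinish_in_path_image by blast

text \<open>Intervals without one or both ends are connected. The punctured versions allow a
  connectedness argument for an arc that touches a closed curve only at its ends.\<close>

lemma arc_between_connected:
  assumes "arc_between a b P"
  shows "connected (P - {a, b})" "connected (P - {a})" "connected (P - {b})" "connected P"
proof -
  obtain g where g: "Path_Connected.arc g" "pathstart g = a" "pathfinish g = b" "path_image g = P"
    using assms(1) by (rule arc_betweenE)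
  have inj: "inj_on g {0..1}" and cont: "continuous_on {0..1} g"
    using g(1) by (auto simp: Path_Connected.arc_def path_def)
  have a: "g 0 = a" and b: "g 1 = b" using g by (auto simp: pathstart_def pathfinish_def)
  have P: "P = g ` {0..1}" using g by (simp add: path_image_def)
  have *: "connected (P - {g t | t. t \<in> T})" if "T \<subseteq> {0..1}" "connected ({0..1} - T)" for T :: "real set"
  proof -
    have "P - {g t | t. t \<in> T} = g ` ({0..1} - T)"
      unfolding P using inj that(1) by (subst inj_on_image_set_diff[of g "{0..1}"]) auto
    then show ?thesis
      using connected_continuous_image[OF continuous_on_subset[OF cont] that(2)] by auto
  qed
  have "{0..1} - {0, 1::real} = {0<..<1}" "{0..1} - {0::real} = {0<..1}" "{0..1} - {1::real} = {0..<1}"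
    by auto
  moreover have "{g t | t. t \<in> {0, 1}} = {a, b}" "{g t | t. t \<in> {0}} = {a}" "{g t | t. t \<in> {1}} = {b}"
    using a b by auto
  ultimately show "connected (P - {a, b})" "connected (P - {a})" "connected (P - {b})"
    using *[of "{0, 1}"] *[of "{0}"] *[of "{1}"] by (simp_all add: connected_Ioo connected_Ioc connected_Ico)
  show "connected P"
    unfolding P using cont by (simp add: connected_continuous_image)
qed

lemma jordan_arcs:
  assumes "arc_between a b P" "arc_between a b Q" "P \<inter> Q = {a, b}"
  shows "\<exists>g. simple_path g \<and> pathfinish g = pathstart g \<and> path_image g = P \<union> Q"
proof -
  obtain g h where g: "Path_Connected.arc g" "pathstart g = a" "pathfinish g = b" "path_image g = P"
    and h: "Path_Connected.arc h" "pathstart h = b" "pathfinish h = a" "path_image h = Q"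
    using assms(1) arc_between_sym[OF assms(2)] by (metis arc_betweenE)
  have "simple_path (g +++ h)"
    using g h assms(3) by (intro simple_path_join_loop) auto
  then show ?thesis using g h
    by (intro exI[of _ "g +++ h"]) (simp add: path_image_join)
qed

text \<open>This is \<open>split_inside_simple_closed_curve\<close> restated for images of arcs, so
  that the three arcs of a theta curve can be permuted freely.\<close>

lemma theta_split:
  assumes "arc_between a b P" "arc_between a b Q" "arc_between a b R"
    and "P \<inter> Q = {a, b}" "P \<inter> R = {a, b}" "Q \<inter> R = {a, b}"
    and "R \<inter> inside (P \<union> Q) \<noteq> {}"
  shows "inside (P \<union> R) \<inter> inside (Q \<union> R) = {}"
    and "inside (P \<union> R) \<union> inside (Q \<union> R) \<union> (R - {a, b}) = inside (P \<union> Q)"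
proof -
  obtain p q r where
    p: "Path_Connected.arc p" "pathstart p = a" "pathfinish p = b" "path_image p = P" and
    q: "Path_Connected.arc q" "pathstart q = a" "pathfinish q = b" "path_image q = Q" and
    r: "Path_Connected.arc r" "pathstart r = a" "pathfinish r = b" "path_image r = R"
    using assms(1-3) by (metis arc_betweenE)
  have "a \<noteq> b" using assms(1) arc_between_ends by blast
  note * = split_inside_simple_closed_curve[OF arc_imp_simple_path[OF p(1)] p(2,3)
      arc_imp_simple_path[OF q(1)] q(2,3) arc_imp_simple_path[OF r(1)] r(2,3) this,
      unfolded p(4) q(4) r(4), OF assms(4-7)]
  show "inside (P \<union> R) \<inter> inside (Q \<union> R) = {}" by (rule *)
  show "inside (P \<union> R) \<union> inside (Q \<union> R) \<union> (R - {a, b}) = inside (P \<union> Q)" by (rule *)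
qed

lemma same_side_if_connected:
  assumes "connected C" "C \<inter> J = {}" "x \<in> C" "y \<in> C"
  shows "x \<in> inside J \<longleftrightarrow> y \<in> inside J"
proof -
  have "connected_component (- J) x y"
    using assms by (auto simp: connected_component_def)
  then show ?thesis
    by (meson connected_component_sym inside_same_component)
qed

lemma theta_jordan:
  assumes "arc_between a b P" "arc_between a b Q" "P \<inter> Q = {a, b}"
  shows "open (inside (P \<union> Q))" "connected (inside (P \<union> Q))" "inside (P \<union> Q) \<noteq> {}"
    "open (outside (P \<union> Q))" "connected (outside (P \<union> Q))" "\<not> bounded (outside (P \<union> Q))"
    "inside (P \<union> Q) \<inter> outside (P \<union> Q) = {}" "inside (P \<union> Q) \<union> outside (P \<union> Q) = - (P \<union> Q)"
    "closure (inside (P \<union> Q)) = inside (P \<union> Q) \<union> (P \<union> Q)" "closure (outside (P \<union> Q)) = outside (P \<union> Q) \<union> (P \<union> Q)"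
    "bounded (inside (P \<union> Q))"
proof -
  obtain g where g: "simple_path g" "pathfinish g = pathstart g" "path_image g = P \<union> Q"
    using jordan_arcs[OF assms] by blast
  note J = Jordan_inside_outside[OF g(1,2), unfolded g(3)]
  show "open (inside (P \<union> Q))" "connected (inside (P \<union> Q))" "inside (P \<union> Q) \<noteq> {}"
    "open (outside (P \<union> Q))" "connected (outside (P \<union> Q))" "\<not> bounded (outside (P \<union> Q))"
    "inside (P \<union> Q) \<inter> outside (P \<union> Q) = {}" "inside (P \<union> Q) \<union> outside (P \<union> Q) = - (P \<union> Q)"
    "bounded (inside (P \<union> Q))"
    using J by blast+
  show "closure (inside (P \<union> Q)) = inside (P \<union> Q) \<union> (P \<union> Q)"
    "closure (outside (P \<union> Q)) = outside (P \<union> Q) \<union> (P \<union> Q)"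
    using J by (metis closure_Un_frontier)+
qed

lemma inside_not_mem: "x \<in> inside S \<Longrightarrow> x \<notin> S"
  using inside_no_overlap by blast

text \<open>The arc without its ends is connected and misses the closed curve, so one point inside
  drags all of it inside.\<close>

lemma theta_interior_same_side:
  assumes "arc_between a b R" "P \<inter> R = {a, b}" "Q \<inter> R = {a, b}"
    and "R \<inter> inside (P \<union> Q) \<noteq> {}"
  shows "R - {a, b} \<subseteq> inside (P \<union> Q)"
proof
  fix x assume x: "x \<in> R - {a, b}"
  obtain y where y: "y \<in> R" "y \<in> inside (P \<union> Q)" using assms(4) by blast
  have "y \<notin> P" using inside_not_mem[OF y(2)] by simp
  then have "y \<notin> {a, b}" using assms(2) by auto
  moreover have "(R - {a, b}) \<inter> (P \<union> Q) = {}" using assms(2,3) by auto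
  ultimately show "x \<in> inside (P \<union> Q)"
    using same_side_if_connected[OF arc_between_connected(1)[OF assms(1)], of "P \<union> Q" x y] x y by simp
qed

text \<open>Two arcs drawn inside a closed curve are nested with respect to \<open>P0\<close>:
  whichever lies nearer to \<open>P1\<close> encloses the other together with \<open>P0\<close>, and
  leaves \<open>P1\<close> out.\<close>

lemma four_arcs_inside:
  assumes arcs: "arc_between a b P0" "arc_between a b P1" "arc_between a b P2" "arc_between a b P3"
    and disj: "P0 \<inter> P1 = {a, b}" "P0 \<inter> P2 = {a, b}" "P0 \<inter> P3 = {a, b}"
       "P1 \<inter> P2 = {a, b}" "P1 \<inter> P3 = {a, b}" "P2 \<inter> P3 = {a, b}"
    and in2: "P2 \<inter> inside (P0 \<union> P1) \<noteq> {}" and in3: "P3 \<inter> inside (P0 \<union> P1) \<noteq> {}"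
  shows "(P3 - {a, b} \<subseteq> inside (P0 \<union> P2) \<and> P1 \<inter> inside (P0 \<union> P2) = {}) \<or>
         (P2 - {a, b} \<subseteq> inside (P0 \<union> P3) \<and> P1 \<inter> inside (P0 \<union> P3) = {})"
proof -
  note s2 = theta_split[OF arcs(1,2,3) disj(1,2,4) in2]
  note s3 = theta_split[OF arcs(1,2,4) disj(1,3,5) in3]
  have i2: "P2 - {a, b} \<subseteq> inside (P0 \<union> P1)" and i3: "P3 - {a, b} \<subseteq> inside (P0 \<union> P1)"
    using theta_interior_same_side[OF arcs(3) disj(2,4) in2] theta_interior_same_side[OF arcs(4) disj(3,5) in3]
    by simp_all
  have ab: "a \<in> P0" "b \<in> P0" "a \<in> P1" "b \<in> P1" "a \<in> P2" "b \<in> P2" "a \<in> P3" "b \<in> P3"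
    using disj by auto
  have ne2: "P2 - {a, b} \<noteq> {}" and ne3: "P3 - {a, b} \<noteq> {}"
    using in2 in3 inside_no_overlap[of "P0 \<union> P1"] ab by (fastforce simp: disjoint_iff)+
  have P1: "P1 \<inter> inside (P0 \<union> P2) = {}" "P1 \<inter> inside (P0 \<union> P3) = {}"
    using s2(2) s3(2) inside_not_mem[of _ "P0 \<union> P1"] by (blast, blast)
  show ?thesis
  proof (rule ccontr)
    assume neg: "\<not> ?thesis"
    have a3: "P3 \<inter> inside (P0 \<union> P2) = {}"
      using neg P1(1) theta_interior_same_side[OF arcs(4) disj(3,6)] by argo
    have a2: "P2 \<inter> inside (P0 \<union> P3) = {}"
      using neg P1(2) theta_interior_same_side[OF arcs(3) disj(2)] disj(6) by (metis Int_commute)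
    \<comment> \<open>\<open>P2\<close> halves the inside of \<open>P0 \<union> P1\<close>, and so
      does \<open>P3\<close>. If neither of the two arcs lies in the half next to \<open>P0\<close>
      that the other cuts off, each lies in the other's half next to \<open>P1\<close>. Splitting
      once more then puts \<open>P2\<close> inside a curve that contains \<open>P2\<close>.\<close>
    have b3: "P3 - {a, b} \<subseteq> inside (P1 \<union> P2)" using s2(2) i3 a3 disj(6) by auto
    have b2: "P2 - {a, b} \<subseteq> inside (P1 \<union> P3)" using s3(2) i2 a2 disj(6) by auto
    have "P3 \<inter> inside (P1 \<union> P2) \<noteq> {}" using b3 ne3 by auto
    from theta_split(2)[OF arcs(2,3,4) disj(4,5,6) this]
    have "inside (P1 \<union> P3) \<subseteq> inside (P1 \<union> P2)" by auto
    then have "P2 - {a, b} \<subseteq> inside (P1 \<union> P2)" using b2 by simp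
    then show False using ne2 inside_not_mem[of _ "P1 \<union> P2"] by blast
  qed
qed

lemma arc_between_homeomorphic_image:
  assumes "arc_between a b P" "continuous_on P f" "inj_on f P"
  shows "arc_between (f a) (f b) (f ` P)"
proof -
  obtain g where g: "Path_Connected.arc g" "pathstart g = a" "pathfinish g = b" "path_image g = P"
    using assms(1) by (rule arc_betweenE)
  have "Path_Connected.arc (f \<circ> g)"
    using assms g unfolding Path_Connected.arc_def
    by (auto simp: path_continuous_image comp_inj_on path_image_def)
  then show ?thesis unfolding arc_between_def
    using g by (intro exI[of _ "f \<circ> g"]) (auto simp: path_image_compose pathstart_compose pathfinish_compose)
qed

text \<open>The inversion reduces configurations outside a Jordan curve to the inside, where
  \<open>split_inside_simple_closed_curve\<close> applies.\<close>

lemma inversion_outside_to_inside: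
  fixes p :: complex
  defines "f \<equiv> (\<lambda>z. inverse (z - p))"
  assumes P: "arc_between a b P" and Q: "arc_between a b Q" and PQ: "P \<inter> Q = {a, b}"
    and p: "p \<in> inside (P \<union> Q)" and z: "z \<in> outside (P \<union> Q)"
  shows "f z \<in> inside (f ` P \<union> f ` Q)"
proof (rule ccontr)
  assume out: "f z \<notin> inside (f ` P \<union> f ` Q)"
  have pPQ: "p \<notin> P" "p \<notin> Q" using inside_not_mem[OF p] by auto
  have cont: "continuous_on S f" if "p \<notin> S" for S
    unfolding f_def using that by (intro continuous_intros) auto
  have inj: "inj f" by (auto simp: inj_def f_def)
  define J where "J = f ` P \<union> f ` Q"
  have arcs: "arc_between (f a) (f b) (f ` P)" "arc_between (f a) (f b) (f ` Q)"
    using arc_between_homeomorphic_image P Q cont pPQ inj by (meson inj_on_subset subset_UNIV)+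
  have meet: "f ` P \<inter> f ` Q = {f a, f b}"
    using PQ inj by (metis image_Int image_empty image_insert)
  note j = theta_jordan[OF P Q PQ] and j' = theta_jordan[OF arcs meet, folded J_def]
  define O' where "O' = outside (P \<union> Q)"
  define I' where "I' = inside (P \<union> Q)"
  have pO: "p \<notin> O'" using p j(7) by (fastforce simp: O'_def disjoint_iff)
  have disj: "f ` O' \<inter> J = {}" "f ` I' \<inter> J = {}"
    using inside_no_overlap[of "P \<union> Q"] outside_no_overlap[of "P \<union> Q"] inj
    unfolding J_def O'_def I'_def by (simp_all flip: image_Un image_Int)
  have conO: "connected (f ` O')"
    using connected_continuous_image[OF cont[OF pO]] j(5) by (simp add: O'_def)
  have conI: "connected (f ` (I' - {p}))"
    using connected_continuous_image[OF cont[of "I' - {p}"]] connected_open_delete[of I' p] j(1,2) by (simp add: I'_def)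
  have zout: "f z \<in> outside J"
    using out j'(8) disj(1) z unfolding O'_def J_def by blast
  have Oout: "f ` O' \<subseteq> outside J"
  proof
    fix y assume y: "y \<in> f ` O'"
    have "y \<in> inside J \<longleftrightarrow> f z \<in> inside J"
      using same_side_if_connected[OF conO disj(1) y] z by (auto simp: O'_def)
    then show "y \<in> outside J" using zout j'(7,8) y disj(1) by blast
  qed
  obtain w where w: "w \<in> inside J" using j'(3) by blast
  \<comment> \<open>Points far out in the unbounded outside are mapped close to 0, and the image of
    the outside was shown to avoid \<open>inside J\<close>.\<close>
  have "0 \<notin> inside J"
  proof
    assume 0: "0 \<in> inside J"
    obtain e where e: "e > 0" "ball 0 e \<subseteq> inside J" using j'(1) 0 open_contains_ball by blast
    obtain y where y: "y \<in> O'" "norm y > norm p + 1 / e"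
      using j(6) unfolding O'_def bounded_iff by (meson not_le)
    have "norm (y - p) > 1 / e" using y(2) norm_triangle_sub[of y p] by linarith
    then have "inverse (norm (y - p)) < inverse (1 / e)" using e(1) by (intro less_imp_inverse_less) auto
    then have "norm (f y) < e" by (simp add: f_def norm_inverse)
    then have "f y \<in> inside J" using e(2) by auto
    then show False using Oout y j'(7) by blast
  qed
  then have w0: "w \<noteq> 0" using w by blast
  define x where "x = p + inverse w"
  have fx: "f x = w" by (simp add: f_def x_def)
  have xp: "x \<noteq> p" using w0 by (simp add: x_def)
  have "x \<in> I'"
  proof -
    have "x \<notin> O'" using Oout fx w j'(7) by blast
    moreover have "x \<notin> P \<union> Q" using fx inside_not_mem[OF w] by (auto simp: J_def)
    ultimately show ?thesis using j(8) unfolding O'_def I'_def by blast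
  qed
  then have wI: "w \<in> f ` (I' - {p})" using fx xp by blast
  have allin: "f ` (I' - {p}) \<subseteq> inside J"
    using same_side_if_connected[OF conI, of J _ w] wI w disj(2) by blast
  obtain K where K: "K > 0" "\<forall>y\<in>inside J. norm y \<le> K" using j'(11) bounded_pos by blast
  obtain e where e: "e > 0" "ball p e \<subseteq> I'" using j(1) p open_contains_ball unfolding I'_def by blast
  \<comment> \<open>\<open>t < e\<close> keeps \<open>p + t\<close> inside the original curve, while
    \<open>t < 1 / K\<close> sends it to norm \<open>1 / t > K\<close>, beyond the bounded
    \<open>inside J\<close>.\<close>
  define t where "t = min (e / 2) (1 / (2 * K))"
  have t: "t > 0" "t < e" "t < 1 / K" using e K by (auto simp: t_def min_def field_simps)
  have "p + of_real t \<in> I' - {p}" using e(2) t by (auto simp: dist_norm)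
  then have "f (p + of_real t) \<in> inside J" using allin by blast
  moreover have "norm (f (p + of_real t)) = 1 / t" using t by (simp add: f_def norm_divide inverse_eq_divide)
  moreover have "1 / t > K" using K(1) t by (simp add: field_simps)
  ultimately show False using K(2) by fastforce
qed

lemma four_arcs_inside_points:
  assumes arcs: "arc_between a b P0" "arc_between a b P1" "arc_between a b P2" "arc_between a b P3"
    and disj: "P0 \<inter> P1 = {a, b}" "P0 \<inter> P2 = {a, b}" "P0 \<inter> P3 = {a, b}"
       "P1 \<inter> P2 = {a, b}" "P1 \<inter> P3 = {a, b}" "P2 \<inter> P3 = {a, b}"
    and z: "z1 \<in> P1 - {a, b}" "z2 \<in> P2 - {a, b}" "z3 \<in> P3 - {a, b}"
    and "z2 \<in> inside (P0 \<union> P1)" "z3 \<in> inside (P0 \<union> P1)"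
  shows "(z3 \<in> inside (P0 \<union> P2) \<and> z1 \<notin> inside (P0 \<union> P2)) \<or>
         (z2 \<in> inside (P0 \<union> P3) \<and> z1 \<notin> inside (P0 \<union> P3))"
proof -
  have "P2 \<inter> inside (P0 \<union> P1) \<noteq> {}" "P3 \<inter> inside (P0 \<union> P1) \<noteq> {}"
    using assms by blast+
  from four_arcs_inside[OF arcs disj this] show ?thesis
  proof
    assume "P3 - {a, b} \<subseteq> inside (P0 \<union> P2) \<and> P1 \<inter> inside (P0 \<union> P2) = {}"
    then show ?thesis using z by (meson DiffD1 disjoint_iff subsetD)
  next
    assume "P2 - {a, b} \<subseteq> inside (P0 \<union> P3) \<and> P1 \<inter> inside (P0 \<union> P3) = {}"
    then show ?thesis using z by (meson DiffD1 disjoint_iff subsetD)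
  qed
qed

text \<open>In the cyclic order of the four arcs at \<open>a\<close>, one is opposite to
  \<open>P0\<close>, and it separates the remaining two. If no curve separated,
  \<open>four_arcs_inside_points\<close> would place every point outside every curve; an inversion
  about a point inside \<open>P0 \<union> P1\<close> then moves \<open>z2\<close> and
  \<open>z3\<close> inside the image curve, where the same lemma applies.\<close>

theorem four_arcs_separation:
  assumes arcs: "arc_between a b P0" "arc_between a b P1" "arc_between a b P2" "arc_between a b P3"
    and disj: "P0 \<inter> P1 = {a, b}" "P0 \<inter> P2 = {a, b}" "P0 \<inter> P3 = {a, b}"
       "P1 \<inter> P2 = {a, b}" "P1 \<inter> P3 = {a, b}" "P2 \<inter> P3 = {a, b}"
    and z: "z1 \<in> P1 - {a, b}" "z2 \<in> P2 - {a, b}" "z3 \<in> P3 - {a, b}"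
  shows "(z2 \<in> inside (P0 \<union> P1) \<longleftrightarrow> z3 \<notin> inside (P0 \<union> P1)) \<or>
         (z1 \<in> inside (P0 \<union> P2) \<longleftrightarrow> z3 \<notin> inside (P0 \<union> P2)) \<or>
         (z1 \<in> inside (P0 \<union> P3) \<longleftrightarrow> z2 \<notin> inside (P0 \<union> P3))"
proof (rule ccontr)
  assume neg: "\<not> ?thesis"
  then have n: "z2 \<in> inside (P0 \<union> P1) \<longleftrightarrow> z3 \<in> inside (P0 \<union> P1)"
    "z1 \<in> inside (P0 \<union> P2) \<longleftrightarrow> z3 \<in> inside (P0 \<union> P2)"
    "z1 \<in> inside (P0 \<union> P3) \<longleftrightarrow> z2 \<in> inside (P0 \<union> P3)"
    by argo+
  have sym: "P2 \<inter> P1 = {a, b}" "P3 \<inter> P1 = {a, b}" "P3 \<inter> P2 = {a, b}"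
    using disj(4-6) by (simp_all add: Int_commute)
  have out1: "z2 \<notin> inside (P0 \<union> P1)" "z3 \<notin> inside (P0 \<union> P1)"
    using four_arcs_inside_points[OF arcs disj z] n by metis+
  have out2: "z1 \<notin> inside (P0 \<union> P2)" "z3 \<notin> inside (P0 \<union> P2)"
    using four_arcs_inside_points[OF arcs(1,3,2,4) disj(2,1,3) sym(1) disj(6,5) z(2,1,3)] n by metis+
  have out3: "z1 \<notin> inside (P0 \<union> P3)" "z2 \<notin> inside (P0 \<union> P3)"
    using four_arcs_inside_points[OF arcs(1,4,2,3) disj(3,1,2) sym(2,3) disj(4) z(3,1,2)] n by metis+
  have avoid: "x \<notin> Q" if "x \<in> P - {a, b}" "P \<inter> Q = {a, b}" for x P Q
    using that by blast
  have "z1 \<notin> P0" "z2 \<notin> P0" "z3 \<notin> P0"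
    using avoid[OF z(1), of P0] avoid[OF z(2), of P0] avoid[OF z(3), of P0] disj(1-3)
    by (simp_all add: Int_commute)
  then have off: "z1 \<notin> P0 \<union> P2" "z3 \<notin> P0 \<union> P2" "z1 \<notin> P0 \<union> P3" "z2 \<notin> P0 \<union> P3"
    "z2 \<notin> P0 \<union> P1" "z3 \<notin> P0 \<union> P1"
    using avoid[OF z(1)] avoid[OF z(2)] avoid[OF z(3)] disj(4-6) sym by simp_all
  note j1 = theta_jordan[OF arcs(1,2) disj(1)]
  obtain p where p: "p \<in> inside (P0 \<union> P1)" using j1(3) by blast
  define f where "f = (\<lambda>z. inverse (z - p))"
  have zout: "z2 \<in> outside (P0 \<union> P1)" "z3 \<in> outside (P0 \<union> P1)"
    using out1 j1(8) off(5,6) by blast+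
  have finside: "f z2 \<in> inside (f ` P0 \<union> f ` P1)" "f z3 \<in> inside (f ` P0 \<union> f ` P1)"
    using inversion_outside_to_inside[OF arcs(1,2) disj(1) p] zout by (auto simp: f_def)
  have pP: "p \<notin> P0" "p \<notin> P1" using inside_not_mem[OF p] by auto
  have ab: "p \<noteq> a" "p \<noteq> b" using pP disj(1) by auto
  have side: "P - {a, b} \<subseteq> inside (P0 \<union> P1)" if "arc_between a b P" "P0 \<inter> P = {a, b}" "P1 \<inter> P = {a, b}" "p \<in> P" for P
    using theta_interior_same_side[OF that(1-3)] that(4) p by (meson disjoint_iff)
  have pP': "p \<notin> P2" "p \<notin> P3"
    using side[OF arcs(3) disj(2,4)] side[OF arcs(4) disj(3,5)] z out1 by (meson subsetD)+
  have cont: "continuous_on S f" if "p \<notin> S" for S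
    unfolding f_def using that by (intro continuous_intros) auto
  have inj: "inj f" by (auto simp: inj_def f_def)
  have arcs': "arc_between (f a) (f b) (f ` P0)" "arc_between (f a) (f b) (f ` P1)"
     "arc_between (f a) (f b) (f ` P2)" "arc_between (f a) (f b) (f ` P3)"
    using arc_between_homeomorphic_image arcs cont pP pP' inj by (meson inj_on_subset subset_UNIV)+
  have meet: "f ` P \<inter> f ` Q = {f a, f b}" if "P \<inter> Q = {a, b}" for P Q
    using that inj by (metis image_Int image_empty image_insert)
  have same: "f x \<in> inside (f ` P0 \<union> f ` P) \<longleftrightarrow> f y \<in> inside (f ` P0 \<union> f ` P)"
    if P: "arc_between a b P" "P0 \<inter> P = {a, b}" and xy: "x \<in> outside (P0 \<union> P)" "y \<in> outside (P0 \<union> P)"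
      and ne: "x \<noteq> p" "y \<noteq> p" for x y P
  proof (rule same_side_if_connected)
    note j = theta_jordan[OF arcs(1) P]
    \<comment> \<open>The centre \<open>p\<close> may itself lie outside
      \<open>P0 \<union> P\<close>. Deleting one point from a connected open plane set keeps it
      connected, so points outside have images on a common side.\<close>
    show "connected (f ` (outside (P0 \<union> P) - {p}))"
      using j(4,5) by (intro connected_continuous_image cont connected_open_delete) auto
    show "f ` (outside (P0 \<union> P) - {p}) \<inter> (f ` P0 \<union> f ` P) = {}"
    proof -
      have "(outside (P0 \<union> P) - {p}) \<inter> (P0 \<union> P) = {}"
        using outside_no_overlap[of "P0 \<union> P"] by blast
      then show ?thesis using inj by (simp flip: image_Un image_Int)
    qed
  qed (use xy ne in auto)
  have zp: "z1 \<noteq> p" "z2 \<noteq> p" "z3 \<noteq> p" using z pP pP' by auto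
  have o2: "z1 \<in> outside (P0 \<union> P2)" "z3 \<in> outside (P0 \<union> P2)"
    using out2 theta_jordan(8)[OF arcs(1,3) disj(2)] off(1,2) by blast+
  have o3: "z1 \<in> outside (P0 \<union> P3)" "z2 \<in> outside (P0 \<union> P3)"
    using out3 theta_jordan(8)[OF arcs(1,4) disj(3)] off(3,4) by blast+
  have fz: "f z1 \<in> f ` P1 - {f a, f b}" "f z2 \<in> f ` P2 - {f a, f b}" "f z3 \<in> f ` P3 - {f a, f b}"
    using z inj by (auto simp: inj_def)
  from four_arcs_inside_points[OF arcs' disj[THEN meet] fz finside]
  show False using same[OF arcs(3) disj(2) o2 zp(1,3)] same[OF arcs(4) disj(3) o3 zp(1,2)] by metis
qed

section \<open>Drawings with a dominating vertex\<close>

lemma dominating_vertex_iff: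
  assumes "pair_graph G"
  shows "dominating_vertex G v \<longleftrightarrow> v \<in> pverts G \<and> (\<forall>w\<in>pverts G. w \<noteq> v \<longrightarrow> (v, w) \<in> parcs G)"
proof -
  interpret pair_graph G by fact
  define N where "N = {w. (v, w) \<in> parcs G}"
  have "out_arcs (with_proj G) v = Pair v ` N" by (auto simp: out_arcs_def N_def)
  then have deg: "out_degree (with_proj G) v = card N"
    by (simp add: out_degree_def card_image inj_on_def)
  have N: "N \<subseteq> pverts G - {v}"
    using in_arcsD2 pair_no_loops by (fastforce simp: N_def)
  show ?thesis
  proof (cases "v \<in> pverts G")
    case True
    then have "card N = card (pverts G) - 1 \<longleftrightarrow> N = pverts G - {v}"
      using N card_subset_eq[of "pverts G - {v}" N] by (auto simp: card_Diff_singleton)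
    then show ?thesis using True N by (auto simp: dominating_vertex_def deg N_def)
  qed (auto simp: dominating_vertex_def)
qed

locale apex_drawing =
  fixes G :: "'a pair_pre_digraph" and p c v
  assumes graph: "pair_graph G" and drawing: "plane_drawing G p c" and dominating: "dominating_vertex G v"
begin

sublocale pair_graph G by (rule graph)

lemma arc_ends: "(a, b) \<in> parcs G \<Longrightarrow> a \<in> pverts G \<and> b \<in> pverts G \<and> a \<noteq> b"
  using in_arcsD1 in_arcsD2 pair_no_loops by fastforce

definition E :: "'a \<Rightarrow> 'a \<Rightarrow> bool" where "E a b \<longleftrightarrow> (a, b) \<in> parcs G \<and> a \<noteq> v \<and> b \<noteq> v"

lemma E_arc: "E a b \<Longrightarrow> (a, b) \<in> parcs G" "E a b \<Longrightarrow> a \<noteq> v" "E a b \<Longrightarrow> b \<noteq> v"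
  by (simp_all add: E_def)

definition edge_image :: "'a \<Rightarrow> 'a \<Rightarrow> complex set" where "edge_image a b = path_image (c {a, b})"

text \<open>The triangle v-a-b is bracketed as the edge v-b against the path v-a-b, the two arcs to
  which \<open>theta_jordan\<close> applies. The combinatorial part only ever compares sides, so
  calling the inside True is an arbitrary choice.\<close>

definition side :: "'a \<Rightarrow> 'a \<Rightarrow> 'a \<Rightarrow> bool" where
  "side a b x \<longleftrightarrow> p x \<in> inside (edge_image v b \<union> (edge_image v a \<union> edge_image a b))"

lemma edge_image_sym: "edge_image a b = edge_image b a" by (simp add: edge_image_def insert_commute)

lemma side_sym: "side a b = side b a"
  by (rule ext) (simp add: side_def edge_image_sym[of a b] Un_ac)

lemma E_sym: "E a b \<Longrightarrow> E b a" using arcs_symmetric by (simp add: E_def)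

lemma E_in: "E a b \<Longrightarrow> a \<in> pverts G \<and> b \<in> pverts G \<and> a \<noteq> b"
  using arc_ends[of a b] by (simp add: E_def)

lemma apex_edge: "x \<in> pverts G \<Longrightarrow> x \<noteq> v \<Longrightarrow> (v, x) \<in> parcs G"
  using dominating dominating_vertex_iff[OF graph] by blast

lemma apex_in: "v \<in> pverts G" using dominating by (simp add: dominating_vertex_def)

lemma position_inj: "x \<in> pverts G \<Longrightarrow> y \<in> pverts G \<Longrightarrow> p x = p y \<longleftrightarrow> x = y"
  using drawing by (auto simp: plane_drawing_def inj_on_def)

lemma arc_edge_image: "(a, b) \<in> parcs G \<Longrightarrow> arc_between (p a) (p b) (edge_image a b)"
proof -
  assume ab: "(a, b) \<in> parcs G"
  then have *: "Path_Connected.arc (c {a, b})" "{pathstart (c {a, b}), pathfinish (c {a, b})} = {p a, p b}"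
    using drawing by (auto simp: plane_drawing_def)
  then consider "pathstart (c {a, b}) = p a" "pathfinish (c {a, b}) = p b"
    | "pathstart (c {a, b}) = p b" "pathfinish (c {a, b}) = p a"
    by (auto simp: doubleton_eq_iff)
  then show ?thesis
  proof cases
    case 1 then show ?thesis using * by (auto simp: arc_between_def edge_image_def)
  next
    case 2 then have "arc_between (p b) (p a) (edge_image a b)" using * by (auto simp: arc_between_def edge_image_def)
    then show ?thesis by (rule arc_between_sym)
  qed
qed

lemma vertex_in_edge_image:
  assumes "(a, b) \<in> parcs G" "x \<in> pverts G"
  shows "p x \<in> edge_image a b \<longleftrightarrow> x = a \<or> x = b"
proof
  assume "p x \<in> edge_image a b"
  moreover have "edge_image a b \<inter> p ` pverts G \<subseteq> {p a, p b}"
    using drawing assms(1) unfolding plane_drawing_def edge_image_def by blast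
  ultimately have "p x \<in> {p a, p b}" using assms(2) by blast
  then show "x = a \<or> x = b" using position_inj assms arc_ends[OF assms(1)] by auto
qed (use arc_between_ends[OF arc_edge_image[OF assms(1)]] in auto)

lemma edge_image_Int:
  assumes "(a, b) \<in> parcs G" "(x, y) \<in> parcs G" "{a, b} \<noteq> {x, y}"
  shows "edge_image a b \<inter> edge_image x y = p ` ({a, b} \<inter> {x, y})"
proof
  show "edge_image a b \<inter> edge_image x y \<subseteq> p ` ({a, b} \<inter> {x, y})"
    using drawing assms unfolding plane_drawing_def edge_image_def by blast
  show "p ` ({a, b} \<inter> {x, y}) \<subseteq> edge_image a b \<inter> edge_image x y"
    using assms(1,2) arc_ends[OF assms(1)] by (auto simp: vertex_in_edge_image)
qed

lemma via_arc:
  assumes "E a b"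
  shows "arc_between (p v) (p b) (edge_image v a \<union> edge_image a b)"
proof (rule arc_between_join)
  show "arc_between (p v) (p a) (edge_image v a)" using apex_edge E_in[OF assms] E_arc[OF assms] by (blast intro: arc_edge_image)
  show "arc_between (p a) (p b) (edge_image a b)" using E_arc(1)[OF assms] by (rule arc_edge_image)
  show "edge_image v a \<inter> edge_image a b \<subseteq> {p a}"
    using edge_image_Int[OF apex_edge[of a], of a b] E_in[OF assms] E_arc[OF assms] by (auto simp: doubleton_eq_iff)
qed

lemma apex_arc: "x \<in> pverts G \<Longrightarrow> x \<noteq> v \<Longrightarrow> arc_between (p v) (p x) (edge_image v x)"
  using apex_edge arc_edge_image by blast

lemma triangle_Int:
  assumes "E a b"
  shows "edge_image v b \<inter> (edge_image v a \<union> edge_image a b) = {p v, p b}"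
proof -
  note e = E_in[OF assms] E_arc[OF assms]
  have "edge_image v b \<inter> edge_image v a = {p v}" "edge_image v b \<inter> edge_image a b = {p b}"
    using edge_image_Int[OF apex_edge apex_edge, of b a] edge_image_Int[OF apex_edge, of b a b] e assms
    by (auto simp: doubleton_eq_iff)
  then show ?thesis by blast
qed

lemma not_in_triangle:
  assumes "E a b" "x \<in> pverts G" "x \<noteq> v" "x \<noteq> a" "x \<noteq> b"
  shows "p x \<notin> edge_image v b \<union> (edge_image v a \<union> edge_image a b)"
  using assms E_in[OF assms(1)] E_arc[OF assms(1)] vertex_in_edge_image apex_edge by auto

lemma drawn_edge_same_side:
  assumes "E a b" "E x y" "x \<notin> {a, b}" "y \<notin> {a, b}"
  shows "side a b x = side a b y"
  unfolding side_def
proof (rule same_side_if_connected)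
  note e = E_in[OF assms(1)] E_in[OF assms(2)] E_arc[OF assms(1)] E_arc[OF assms(2)]
  show "connected (edge_image x y)" using arc_edge_image arc_between_connected(4) E_arc(1)[OF assms(2)] by blast
  have "edge_image x y \<inter> edge_image v b = {}" "edge_image x y \<inter> edge_image v a = {}" "edge_image x y \<inter> edge_image a b = {}"
    using edge_image_Int[of x y v b] edge_image_Int[of x y v a] edge_image_Int[of x y a b] apex_edge[of a] apex_edge[of b] e assms
    by (auto simp: doubleton_eq_iff)
  then show "edge_image x y \<inter> (edge_image v b \<union> (edge_image v a \<union> edge_image a b)) = {}" by blast
  show "p x \<in> edge_image x y" "p y \<in> edge_image x y" using arc_between_ends[OF arc_edge_image] E_arc(1)[OF assms(2)] by blast+
qed

lemma via_Int:
  assumes "E a w" "E b w" "a \<noteq> b"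
  shows "(edge_image v a \<union> edge_image a w) \<inter> (edge_image v b \<union> edge_image b w) = {p v, p w}"
proof -
  note e = E_in[OF assms(1)] E_in[OF assms(2)] E_arc[OF assms(1)] E_arc[OF assms(2)]
  have "edge_image v a \<inter> edge_image v b = {p v}" "edge_image v a \<inter> edge_image b w = {}" "edge_image a w \<inter> edge_image v b = {}" "edge_image a w \<inter> edge_image b w = {p w}"
    using edge_image_Int[of v a v b] edge_image_Int[of v a b w] edge_image_Int[of a w v b] edge_image_Int[of a w b w]
      apex_edge[of a] apex_edge[of b] e assms
    by (auto simp: doubleton_eq_iff)
  then show ?thesis by blast
qed

lemma drawn_star_separation:
  assumes "E w z1" "E w z2" "E w z3" "z1 \<noteq> z2" "z1 \<noteq> z3" "z2 \<noteq> z3"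
  shows "side w z1 z2 \<noteq> side w z1 z3 \<or> side w z2 z1 \<noteq> side w z2 z3 \<or> side w z3 z1 \<noteq> side w z3 z2"
proof -
  have E: "E z1 w" "E z2 w" "E z3 w" using assms E_sym by blast+
  note e = E_in[OF E(1)] E_in[OF E(2)] E_in[OF E(3)] E_arc[OF E(1)] E_arc[OF E(2)] E_arc[OF E(3)]
  \<comment> \<open>The vertex \<open>z\<close> itself serves as the inner point that represents the
    path v-z-w.\<close>
  have z: "p z \<in> (edge_image v z \<union> edge_image z w) - {p v, p w}" if "E z w" for z
    using E_arc[OF that] E_in[OF that] apex_in vertex_in_edge_image[OF apex_edge, of z z] by (auto simp: position_inj)
  have "arc_between (p v) (p w) (edge_image v w)" using apex_arc e by blast
  from four_arcs_separation[OF this via_arc[OF E(1)] via_arc[OF E(2)] via_arc[OF E(3)]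
      triangle_Int[OF E(1)] triangle_Int[OF E(2)] triangle_Int[OF E(3)] 
      via_Int[OF E(1,2) assms(4)] via_Int[OF E(1,3) assms(5)] via_Int[OF E(2,3) assms(6)]
      z[OF E(1)] z[OF E(2)] z[OF E(3)]]
  show ?thesis unfolding side_sym[of w] side_def by metis
qed

text \<open>
  The side \<open>D\<close> of the triangle \<open>v w z\<close> that does not contain \<open>s\<close> is disjoint from the triangle
  \<open>v s y\<close>, so the closure of \<open>D\<close> minus that triangle lies on one side of it.
\<close>

lemma drawn_nested_sides:
  assumes wz: "E w z" and sy: "E s y" and s: "s \<notin> {w, z}"
    and t: "t \<in> pverts G" "t \<noteq> v" "t \<notin> {s, y}" "t \<in> {w, z} \<or> side w z t \<noteq> side w z s"
    and t': "t' \<in> pverts G" "t' \<noteq> v" "t' \<notin> {s, y}" "t' \<in> {w, z} \<or> side w z t' \<noteq> side w z s"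
  shows "side s y t = side s y t'"
proof -
  note e = E_in[OF wz] E_in[OF sy] E_arc[OF wz] E_arc[OF sy]
  define J where "J = edge_image v z \<union> (edge_image v w \<union> edge_image w z)"
  define D where "D = (if side w z s then outside J else inside J)"
  have "arc_between (p v) (p z) (edge_image v z)" using apex_arc e by blast
  note j = theta_jordan[OF this via_arc[OF wz] triangle_Int[OF wz], folded J_def]
  have D: "connected D" "closure D = D \<union> J" "D \<inter> J = {}"
    using j(2,5,9,10) inside_no_overlap[of J] outside_no_overlap[of J] by (auto simp: D_def)
  have side_J: "side w z x \<longleftrightarrow> p x \<in> inside J" for x by (simp add: side_def J_def)
  have memD: "p x \<in> D \<longleftrightarrow> side w z x \<noteq> side w z s" if "p x \<notin> J" for x
  proof -
    have "p x \<in> outside J \<longleftrightarrow> p x \<notin> inside J" using that j(7,8) by blast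
    then show ?thesis unfolding D_def side_J by simp
  qed
  have sJ: "p s \<notin> J" using not_in_triangle[OF wz] s e sy by (auto simp: J_def)
  have avoid: "C \<inter> D = {}" if "connected C" "C \<inter> J = {}" "p x \<in> C" "p x \<notin> D" for C x
  proof -
    have "q \<in> D \<longleftrightarrow> p x \<in> D" if "q \<in> C" for q
    proof -
      have "q \<in> inside J \<longleftrightarrow> p x \<in> inside J"
        using same_side_if_connected[OF \<open>connected C\<close> \<open>C \<inter> J = {}\<close> that \<open>p x \<in> C\<close>] .
      moreover have "r \<in> outside J \<longleftrightarrow> r \<notin> inside J" if "r \<in> C" for r
        using j(7,8) \<open>C \<inter> J = {}\<close> that by blast
      ultimately show ?thesis using that \<open>p x \<in> C\<close> by (simp add: D_def)
    qed
    then show ?thesis using \<open>p x \<notin> D\<close> by blast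
  qed
  \<comment> \<open>The spoke starts at \<open>p v\<close>, which lies on \<open>J\<close>; only
    after removing this point is it disjoint from \<open>J\<close> and hence on one side.\<close>
  have spoke: "edge_image v x \<inter> D = {}" if x: "x \<in> pverts G" "x \<noteq> v" "x \<notin> {w, z}" "p x \<notin> D" for x
  proof -
    have "(edge_image v x - {p v}) \<inter> J = {}"
      using edge_image_Int[of v x v z] edge_image_Int[of v x v w] edge_image_Int[of v x w z] apex_edge x wz e
      by (auto simp: J_def doubleton_eq_iff)
    moreover have "connected (edge_image v x - {p v})"
      using apex_arc[OF x(1,2)] arc_between_connected(2) by blast
    moreover have "p x \<in> edge_image v x - {p v}"
      using x apex_in vertex_in_edge_image[OF apex_edge, of x x] by (auto simp: position_inj)
    ultimately have "(edge_image v x - {p v}) \<inter> D = {}" using avoid x(4) by blast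
    moreover have "p v \<in> J" using vertex_in_edge_image[OF apex_edge apex_in] e wz by (auto simp: J_def)
    ultimately show ?thesis using D(3) by blast
  qed
  have ps: "p s \<notin> D" using memD[OF sJ] by simp
  have edge_part: "(edge_image s y - {p y}) \<inter> D = {}"
  proof (rule avoid[OF _ _ _ ps])
    show "connected (edge_image s y - {p y})" using arc_edge_image e arc_between_connected(3) by blast
    show "(edge_image s y - {p y}) \<inter> J = {}"
      using edge_image_Int[of s y v z] edge_image_Int[of s y v w] edge_image_Int[of s y w z] apex_edge[of z] apex_edge[of w] s sy wz e
      by (auto simp: J_def doubleton_eq_iff)
    show "p s \<in> edge_image s y - {p y}"
      using e sy vertex_in_edge_image[of s y s] by (auto simp: position_inj)
  qed
  \<comment> \<open>The triangles may share the vertex \<open>y\<close>; then the spoke to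
    \<open>y\<close> is part of \<open>J\<close>. Otherwise \<open>y\<close> is on the side of
    \<open>s\<close> by the edge from \<open>s\<close> to \<open>y\<close>.\<close>
  have y_part: "p y \<notin> D \<and> edge_image v y \<inter> D = {}"
  proof (cases "y \<in> {w, z}")
    case True
    then have "edge_image v y \<subseteq> J" by (auto simp: J_def)
    moreover have "p y \<in> edge_image v y" using vertex_in_edge_image[OF apex_edge, of y y] e sy by auto
    ultimately show ?thesis using D(3) by blast
  next
    case False
    then have "p y \<notin> J" using not_in_triangle[OF wz] e sy by (auto simp: J_def)
    then have "p y \<notin> D" using memD drawn_edge_same_side[OF wz sy s False] by blast
    then show ?thesis using spoke[of y] False e sy by blast
  qed
  have disj: "(edge_image v y \<union> (edge_image v s \<union> edge_image s y)) \<inter> D = {}"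
    using spoke[of s] edge_part y_part s e sy ps by blast
  have tD: "p x \<in> D \<union> J" if "x \<in> pverts G" "x \<noteq> v" "x \<in> {w, z} \<or> side w z x \<noteq> side w z s" for x
  proof (cases "x \<in> {w, z}")
    case True
    then have "p x \<in> edge_image w z" using vertex_in_edge_image e that(1) by auto
    then show ?thesis by (auto simp: J_def)
  next
    case False
    then have "p x \<notin> J" using not_in_triangle[OF wz] that by (auto simp: J_def)
    then show ?thesis using memD that False by blast
  qed
  \<comment> \<open>\<open>t\<close> and \<open>t'\<close> may be \<open>w\<close> or
    \<open>z\<close>, which lie on the boundary of \<open>D\<close> and not in it. Adding points of
    the closure preserves connectedness.\<close>
  have "connected (D \<union> {p t, p t'})"
    by (rule connected_intermediate_closure[OF D(1)]) (use tD t t' D(2) in auto)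
  then show ?thesis
    unfolding side_def
    by (rule same_side_if_connected)
      (use disj not_in_triangle[OF sy] t t' in auto)
qed

end

section \<open>Graphs whose edges have two sides\<close>

lemma obtain_three:
  assumes "\<not> card S \<le> 2"
  obtains x y z where "x \<in> S" "y \<in> S" "z \<in> S" "x \<noteq> y" "x \<noteq> z" "y \<noteq> z"
proof -
  have "3 \<le> card S" using assms by simp
  then obtain T where "T \<subseteq> S" "card T = 3" by (metis obtain_subset_with_card_n)
  then show ?thesis using that by (auto simp: card_3_iff)
qed

lemma obtain_two:
  assumes "\<not> card S \<le> 1"
  obtains x y where "x \<in> S" "y \<in> S" "x \<noteq> y"
proof -
  have "2 \<le> card S" using assms by simp
  then obtain T where "T \<subseteq> S" "card T = 2" by (metis obtain_subset_with_card_n)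
  then show ?thesis using that by (auto simp: card_2_iff)
qed

text \<open>The interface between topology and combinatorics: \<open>E\<close> is the graph without
  its apex, and the last three assumptions are all that is retained of the drawing.
  \<open>nested_sides\<close> expresses that two triangles through the apex do not cross.\<close>

locale sided_graph =
  fixes V :: "'a set" and E :: "'a \<Rightarrow> 'a \<Rightarrow> bool" and side :: "'a \<Rightarrow> 'a \<Rightarrow> 'a \<Rightarrow> bool"
  assumes finite_V: "finite V"
    and E_sym: "E a b \<Longrightarrow> E b a"
    and E_in: "E a b \<Longrightarrow> a \<in> V \<and> b \<in> V \<and> a \<noteq> b"
    and side_sym: "side a b = side b a"
    and edge_same_side: "\<lbrakk>E a b; E x y; x \<notin> {a, b}; y \<notin> {a, b}\<rbrakk> \<Longrightarrow> side a b x = side a b y"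
    and star_separation: "\<lbrakk>E w z1; E w z2; E w z3; z1 \<noteq> z2; z1 \<noteq> z3; z2 \<noteq> z3\<rbrakk> \<Longrightarrow>
      side w z1 z2 \<noteq> side w z1 z3 \<or> side w z2 z1 \<noteq> side w z2 z3 \<or> side w z3 z1 \<noteq> side w z3 z2"
    and nested_sides: "\<lbrakk>E w z; E s y; s \<notin> {w, z}; t \<in> V; t \<notin> {s, y}; t \<in> {w, z} \<or> side w z t \<noteq> side w z s;
      t' \<in> V; t' \<notin> {s, y}; t' \<in> {w, z} \<or> side w z t' \<noteq> side w z s\<rbrakk> \<Longrightarrow> side s y t = side s y t'"
begin

definition N :: "'a \<Rightarrow> 'a set" where "N w = {z. E w z}"

lemma N_subset: "N w \<subseteq> V - {w}" using E_in by (auto simp: N_def)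

lemma finite_N: "finite (N w)" using N_subset finite_V by (meson finite_Diff finite_subset)

text \<open>Three common neighbours of \<open>a\<close> and \<open>b\<close> would form a K_{3,3}
  together with the apex. In terms of sides: for each edge from \<open>a\<close> to one of them, the
  other two are joined through \<open>b\<close> off the triangle, so the star at \<open>a\<close>
  has no separating edge.\<close>

lemma common_neighbours:
  assumes "a \<noteq> b"
  shows "card (N a \<inter> N b) \<le> 2"
proof (rule ccontr)
  assume "\<not> ?thesis"
  then obtain z1 z2 z3 where z: "z1 \<in> N a \<inter> N b" "z2 \<in> N a \<inter> N b" "z3 \<in> N a \<inter> N b"
    "z1 \<noteq> z2" "z1 \<noteq> z3" "z2 \<noteq> z3" by (rule obtain_three)
  have same: "side a x b = side a x y" if "x \<in> N a \<inter> N b" "y \<in> N a \<inter> N b" "x \<noteq> y" for x y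
    using that assms E_in by (intro edge_same_side) (auto simp: N_def)
  show False
    using star_separation[of a z1 z2 z3] z same[of z1 z2] same[of z1 z3] same[of z2 z1] same[of z2 z3]
      same[of z3 z1] same[of z3 z2] by (auto simp: N_def)
qed

text \<open>Descent: a nonempty side of some \<open>u c\<close> with fewest vertices of \<open>T\<close> cannot be refined.\<close>

lemma neighbourhood_one_degenerate:
  assumes "T \<subseteq> N u" "T \<noteq> {}"
  shows "\<exists>c\<in>T. card (N c \<inter> T) \<le> 1"
proof (rule ccontr)
  assume "\<not> ?thesis"
  then have two: "\<not> card (N c \<inter> T) \<le> 1" if "c \<in> T" for c using that by blast
  have fin: "finite T" using assms finite_N finite_subset by blast
  have uT: "u \<notin> T" using assms N_subset by blast
  have uE: "E u c" "E c u" if "c \<in> T" for c using that assms E_sym by (auto simp: N_def)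
  have TV: "c \<in> V" if "c \<in> T" for c using uE[OF that] E_in by blast
  \<comment> \<open>\<open>X (c, \<beta>)\<close> is the part of \<open>T\<close> on side \<beta> of
    the triangle formed by the apex, \<open>u\<close> and \<open>c\<close>; the descent minimizes
    its size over nonempty instances.\<close>
  define X where "X = (\<lambda>(c, \<beta>). {x \<in> T - {c}. side u c x = \<beta>})"
  define P where "P = (\<lambda>cb. fst cb \<in> T \<and> X cb \<noteq> {})"
  obtain c0 where c0: "c0 \<in> T" using assms by blast
  obtain x0 where x0: "x0 \<in> T" "x0 \<noteq> c0"
    using obtain_two[OF two[OF c0]] by (metis IntD2)
  have "P (c0, side u c0 x0)" using c0 x0 by (auto simp: P_def X_def)
  then obtain cb where cb: "P cb" "\<And>cb'. P cb' \<Longrightarrow> card (X cb) \<le> card (X cb')"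
    using ex_has_least_nat[of P _ "\<lambda>k. card (X k)"] by blast
  obtain c \<beta> where [simp]: "cb = (c, \<beta>)" by (cases cb)
  have cT: "c \<in> T" using cb(1) by (simp add: P_def)
  \<comment> \<open>Minimality means that a vertex \<open>s\<close> of the chosen part separates
    nothing from \<open>c\<close>: otherwise the side of \<open>u s\<close> away from
    \<open>c\<close> would be a smaller nonempty part.\<close>
  have same: "side u s r = side u s c" if s: "s \<in> X (c, \<beta>)" and r: "r \<in> T" "r \<noteq> s" for s r
  proof (rule ccontr)
    assume ne: "side u s r \<noteq> side u s c"
    have sT: "s \<in> T" "s \<noteq> c" "side u c s = \<beta>" using s by (auto simp: X_def)
    have "X (s, \<not> side u s c) \<subseteq> X (c, \<beta>) - {s}"
    proof
      fix x assume x: "x \<in> X (s, \<not> side u s c)"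
      then have x': "x \<in> T" "x \<noteq> s" "side u s x \<noteq> side u s c" by (auto simp: X_def)
      have "side u c x = \<beta>"
      proof (rule ccontr)
        assume "side u c x \<noteq> \<beta>"
        \<comment> \<open>If \<open>x\<close> were on the other side of \<open>u c\<close> than
          \<open>s\<close>, then \<open>x\<close> and \<open>c\<close> would both lie in the closed
          side away from \<open>s\<close>, hence on one side of \<open>u s\<close>.\<close>
        then have "side s u x = side s u c"
          using x' sT cT uT TV uE by (intro nested_sides[of u c s u]) auto
        then show False using x' by (simp add: side_sym[of s])
      qed
      then show "x \<in> X (c, \<beta>) - {s}" using x' by (auto simp: X_def)
    qed
    then have "card (X (s, \<not> side u s c)) < card (X (c, \<beta>))"
      using s fin by (intro psubset_card_mono) (auto simp: X_def)
    moreover have "P (s, \<not> side u s c)" using sT r ne by (auto simp: P_def X_def)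
    ultimately show False using cb(2) by fastforce
  qed
  obtain s where s: "s \<in> X (c, \<beta>)" using cb(1) by (auto simp: P_def)
  then have s': "s \<in> T" "s \<noteq> c" "side u c s = \<beta>" by (auto simp: X_def)
  obtain p q where pq: "p \<in> N s \<inter> T" "q \<in> N s \<inter> T" "p \<noteq> q" by (rule obtain_two[OF two[OF s'(1)]])
  have ne: "p \<noteq> s" "q \<noteq> s" using pq N_subset by blast+
  \<comment> \<open>The edge from \<open>s\<close> to \<open>y\<close> keeps \<open>y\<close> in the
    minimal part unless \<open>y = c\<close>, so \<open>same\<close> applies to \<open>y\<close> as
    well. With \<open>p\<close>, \<open>q\<close>, \<open>s\<close> around \<open>u\<close> no edge
    then separates, against \<open>star_separation\<close>.\<close>
  have not_sep: "side u y s = side u y y'" if y: "y \<in> N s \<inter> T" "y' \<in> N s \<inter> T" "y \<noteq> y'" for y y'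
  proof (cases "y = c")
    case True
    then show ?thesis
      using y s' uT uE[of c] cT by (intro edge_same_side) (auto simp: N_def)
  next
    case False
    then have "side u c s = side u c y"
      using y s' uT uE[of c] cT by (intro edge_same_side) (auto simp: N_def)
    then have "y \<in> X (c, \<beta>)" using y False s' by (auto simp: X_def)
    moreover have "s \<noteq> y" "s \<noteq> y'" using y N_subset by blast+
    ultimately show ?thesis using same[of y s] same[of y y'] y s' by auto
  qed
  show False
    using star_separation[of u s p q] uE s' pq ne same[OF s, of p] same[OF s, of q] not_sep[of p q] not_sep[of q p]
    by auto
qed

text \<open>
  The same descent over edges \<open>w z\<close> and their sides not containing \<open>u\<close>; such a side contains no
  neighbour of \<open>u\<close>.
\<close>

lemma outer_two_degenerate:
  assumes u: "u \<in> V" and B: "B \<subseteq> V - insert u (N u)" "B \<noteq> {}"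
  shows "\<exists>w\<in>B. card (N w \<inter> (N u \<union> B)) \<le> 2"
proof (rule ccontr)
  assume "\<not> ?thesis"
  then have three: "\<not> card (N w \<inter> (N u \<union> B)) \<le> 2" if "w \<in> B" for w using that by blast
  define C where "C = N u \<union> B"
  have uC: "u \<notin> C" and CV: "C \<subseteq> V" using B N_subset by (auto simp: C_def)
  have finC: "finite C" using CV finite_V finite_subset by blast
  define X where "X = (\<lambda>(w, z). {x \<in> C - {w, z}. side w z x \<noteq> side w z u})"
  define P where "P = (\<lambda>wz. fst wz \<in> B \<and> snd wz \<in> C \<and> E (fst wz) (snd wz) \<and> X wz \<noteq> {})"
  \<comment> \<open>Among three neighbours of \<open>w\<close> one separates the other two, and one
    of these is then not on the side of \<open>u\<close>.\<close>
  have ex: "\<exists>z. P (w, z)" if "w \<in> B" for w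
  proof -
    have "\<not> card (N w \<inter> C) \<le> 2" using three[OF that] by (simp add: C_def)
    then obtain z1 z2 z3 where z: "z1 \<in> N w \<inter> C" "z2 \<in> N w \<inter> C" "z3 \<in> N w \<inter> C"
      "z1 \<noteq> z2" "z1 \<noteq> z3" "z2 \<noteq> z3" by (rule obtain_three)
    have *: "P (w, z)" if "z \<in> N w \<inter> C" "x \<in> N w \<inter> C" "y \<in> N w \<inter> C" "z \<noteq> x" "z \<noteq> y" "side w z x \<noteq> side w z y" for z x y
    proof -
      have "x \<noteq> w" "y \<noteq> w" using that N_subset by blast+
      then show ?thesis using that \<open>w \<in> B\<close> unfolding P_def X_def by (auto simp: N_def)
    qed
    have E: "E w z1" "E w z2" "E w z3" using z by (auto simp: N_def)
    show ?thesis using star_separation[OF E z(4-6)] *[of z1 z2 z3] *[of z2 z1 z3] *[of z3 z1 z2] z by metis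
  qed
  obtain w0 where "w0 \<in> B" using B by blast
  then obtain z0 where "P (w0, z0)" using ex by blast
  then obtain wz where wz: "P wz" "\<And>wz'. P wz' \<Longrightarrow> card (X wz) \<le> card (X wz')"
    using ex_has_least_nat[of P _ "\<lambda>k. card (X k)"] by blast
  obtain w z where [simp]: "wz = (w, z)" by (cases wz)
  have wz': "w \<in> B" "z \<in> C" "E w z" using wz(1) by (auto simp: P_def)
  obtain s where s: "s \<in> X (w, z)" using wz(1) by (auto simp: P_def)
  then have s': "s \<in> C" "s \<noteq> w" "s \<noteq> z" "side w z s \<noteq> side w z u" by (auto simp: X_def)
  have "u \<notin> {w, z}" using wz' uC by (auto simp: C_def)
  \<comment> \<open>An edge from \<open>u\<close> to \<open>s\<close> avoids \<open>w\<close> and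
    \<open>z\<close>, so it would put \<open>s\<close> on the side of \<open>u\<close>. Hence
    \<open>s\<close> is in \<open>B\<close>, and the descent can continue from it.\<close>
  then have "s \<notin> N u"
    using s' edge_same_side[OF wz'(3), of u s] by (auto simp: N_def)
  then have sB: "s \<in> B" using s'(1) by (simp add: C_def)
  then obtain y where y: "P (s, y)" using ex by blast
  then have y': "y \<in> C" "E s y" by (auto simp: P_def)
  \<comment> \<open>Anything outside the part cut off by \<open>w z\<close> lies, like
    \<open>u\<close>, in the closed side away from \<open>s\<close>, so the edge \<open>s y\<close>
    cannot separate it from \<open>u\<close>.\<close>
  have "X (s, y) \<subseteq> X (w, z) - {s}"
  proof
    fix x assume "x \<in> X (s, y)"
    then have x: "x \<in> C" "x \<noteq> s" "x \<noteq> y" "side s y x \<noteq> side s y u" by (auto simp: X_def)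
    have "x \<in> X (w, z)"
    proof (rule ccontr)
      assume "x \<notin> X (w, z)"
      then have "x \<in> {w, z} \<or> side w z x \<noteq> side w z s" using x s' by (auto simp: X_def)
      then have "side s y x = side s y u"
        using x s' y' uC CV u by (intro nested_sides[OF wz'(3) y'(2)]) auto
      then show False using x by simp
    qed
    then show "x \<in> X (w, z) - {s}" using x by simp
  qed
  then have "card (X (s, y)) < card (X (w, z))"
    using s finC by (intro psubset_card_mono) (auto simp: X_def)
  then show False using wz(2)[OF y] by simp
qed

end

section \<open>Arranging a linear forest along a list\<close>

fun consecutive :: "'a \<Rightarrow> 'a \<Rightarrow> 'a list \<Rightarrow> bool" where
  "consecutive x y (a # b # l) \<longleftrightarrow> x = a \<and> y = b \<or> consecutive x y (b # l)"
| "consecutive x y _ \<longleftrightarrow> False"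

lemma consecutive_append:
  "consecutive x y (K @ L) \<longleftrightarrow>
    consecutive x y K \<or> consecutive x y L \<or> K \<noteq> [] \<and> L \<noteq> [] \<and> x = last K \<and> y = hd L"
proof (induction K)
  case (Cons a K)
  then show ?case by (cases K; cases L) auto
qed auto

lemma consecutive_Cons: "consecutive x y (a # L) \<longleftrightarrow> L \<noteq> [] \<and> x = a \<and> y = hd L \<or> consecutive x y L"
  by (cases L) auto

lemma consecutive_nth: "consecutive x y L \<Longrightarrow> \<exists>i. Suc i < length L \<and> x = L ! i \<and> y = L ! Suc i"
proof (induction x y L rule: consecutive.induct)
  case (1 x y a b l)
  show ?case
  proof (cases "x = a \<and> y = b")
    case True
    then show ?thesis by (intro exI[of _ 0]) auto
  next
    case False
    then obtain i where "Suc i < length (b # l) \<and> x = (b # l) ! i \<and> y = (b # l) ! Suc i" using 1 by auto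
    then show ?thesis by (intro exI[of _ "Suc i"]) auto
  qed
qed auto

text \<open>Induction by removing a vertex of degree at most 1 and inserting it into the list of the
  rest beside its only neighbour. The degree bound leaves a free place there; degeneracy, which
  excludes cycles, supplies the vertex to remove.\<close>

lemma linear_forest_list:
  assumes "finite S"
    and sym: "\<And>x y. F x y \<Longrightarrow> F y x"
    and deg: "\<And>x. x \<in> S \<Longrightarrow> card {y \<in> S. F x y} \<le> 2"
    and degen: "\<And>T. T \<subseteq> S \<Longrightarrow> T \<noteq> {} \<Longrightarrow> \<exists>c\<in>T. card {y \<in> T. F c y} \<le> 1"
    and irrefl: "\<And>x. \<not> F x x"
  shows "\<exists>L. distinct L \<and> set L = S \<and> (\<forall>x\<in>S. \<forall>y\<in>S. F x y \<longrightarrow> consecutive x y L \<or> consecutive y x L)"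
  using assms(1) deg degen
proof (induction "card S" arbitrary: S)
  case 0
  then show ?case by (intro exI[of _ "[]"]) auto
next
  case (Suc n)
  then have "S \<noteq> {}" by auto
  then obtain w where w: "w \<in> S" "card {y \<in> S. F w y} \<le> 1" using Suc.prems(3)[of S] by blast
  define S' where "S' = S - {w}"
  have S': "finite S'" "n = card S'" "S' \<subseteq> S" "S = insert w S'" "w \<notin> S'"
    using Suc.hyps(2) Suc.prems(1) w(1) by (auto simp: S'_def)
  have deg': "card {y \<in> S'. F x y} \<le> 2" if "x \<in> S'" for x
  proof -
    have "card {y \<in> S'. F x y} \<le> card {y \<in> S. F x y}"
      using Suc.prems(1) S'(3) by (intro card_mono) auto
    then show ?thesis using Suc.prems(2)[of x] that S'(3) by auto
  qed
  have degen': "\<exists>c\<in>T. card {y \<in> T. F c y} \<le> 1" if "T \<subseteq> S'" "T \<noteq> {}" for T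
    using Suc.prems(3)[of T] that S'(3) by blast
  have "\<exists>L. distinct L \<and> set L = S' \<and> (\<forall>x\<in>S'. \<forall>y\<in>S'. F x y \<longrightarrow> consecutive x y L \<or> consecutive y x L)"
    by (rule Suc.hyps(1)[OF S'(2,1)]) (use deg' degen' in auto)
  then obtain L where L: "distinct L" "set L = S'"
    "\<And>x y. x \<in> S' \<Longrightarrow> y \<in> S' \<Longrightarrow> F x y \<Longrightarrow> consecutive x y L \<or> consecutive y x L"
    by blast
  show ?case
  proof (cases "\<exists>y\<in>S'. F w y")
    case False
    have "distinct (w # L)" "set (w # L) = S" using L S' by auto
    moreover have "consecutive x y (w # L) \<or> consecutive y x (w # L)" if "x \<in> S" "y \<in> S" "F x y" for x y
      using that False sym irrefl S'(4) L(3)[of x y] by (auto simp: consecutive_Cons)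
    ultimately show ?thesis by blast
  next
    case True
    then obtain y where y: "y \<in> S'" "F w y" by blast
    have only_y: "z = y" if "z \<in> S'" "F w z" for z
    proof (rule ccontr)
      assume "z \<noteq> y"
      then have "card {y, z} \<le> card {y \<in> S. F w y}"
        using that y S' Suc.prems(1) by (intro card_mono) auto
      then show False using w(2) \<open>z \<noteq> y\<close> by simp
    qed
    have nbr: "z = z'" if "z \<in> S'" "F y z" "z' \<in> S'" "F y z'" for z z'
    proof (rule ccontr)
      assume "z \<noteq> z'"
      then have "card {w, z, z'} \<le> card {x \<in> S. F y x}"
        using that y S' Suc.prems(1) sym by (intro card_mono) auto
      moreover have "card {w, z, z'} = 3" using \<open>z \<noteq> z'\<close> that S'(5) by (auto simp: card_insert_if)
      ultimately show False using Suc.prems(2)[of y] y(1) S'(3) by auto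
    qed
    have ins: ?thesis if split: "L = L1 @ L2" and wy: "consecutive w y (L1 @ w # L2) \<or> consecutive y w (L1 @ w # L2)"
        and keep: "L1 \<noteq> [] \<Longrightarrow> L2 \<noteq> [] \<Longrightarrow> \<not> F (last L1) (hd L2)" for L1 L2
    proof -
      have "distinct (L1 @ w # L2)" "set (L1 @ w # L2) = S" using L S' split by auto
      moreover have "consecutive a b (L1 @ w # L2) \<or> consecutive b a (L1 @ w # L2)" if ab: "a \<in> S" "b \<in> S" "F a b" for a b
      proof -
        consider "a = w" | "b = w" | "a \<in> S'" "b \<in> S'" using ab S'(4) by blast
        then show ?thesis
        proof cases
          case 1 then have "b = y" using ab irrefl only_y S'(4) by blast
          then show ?thesis using wy 1 by blast
        next
          case 2 then have "a = y" using ab irrefl only_y S'(4) sym by blast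
          then show ?thesis using wy 2 by blast
        next
          case 3
          have "F b a" using ab(3) sym by blast
          then show ?thesis using L(3)[OF 3 ab(3)] ab(3) keep unfolding split
            by (auto simp: consecutive_append consecutive_Cons)
        qed
      qed
      ultimately show ?thesis by blast
    qed
    \<comment> \<open>Besides \<open>w\<close>, the vertex \<open>y\<close> has at most one
      neighbour, so on at least one side of \<open>y\<close> the list has no edge to break;
      \<open>w\<close> is inserted on that side.\<close>
    obtain L1 L2 where split: "L = L1 @ y # L2" using y(1) L(2) by (metis in_set_conv_decomp)
    show ?thesis
    proof (cases "L2 \<noteq> [] \<and> F y (hd L2)")
      case True
      have "hd L2 \<in> S'" using True L(2) split by auto
      have "\<not> F (last L1) y" if "L1 \<noteq> []"
      proof
        assume "F (last L1) y"
        moreover have "last L1 \<in> S'" using that L(2) split by auto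
        ultimately have "last L1 = hd L2" using nbr True \<open>hd L2 \<in> S'\<close> sym by blast
        then show False using L(1) that True unfolding split
          by (metis append_is_Nil_conv disjoint_iff distinct_append hd_in_set last_in_set list.set_intros(2))
      qed
      then show ?thesis using ins[of L1 "y # L2"] split by (auto simp: consecutive_append)
    next
      case False
      then show ?thesis using ins[of "L1 @ [y]" L2] split by (auto simp: consecutive_append)
    qed
  qed
qed

section \<open>The spectral radius as a maximal Rayleigh quotient\<close>

text \<open>For a symmetric arc set this is x^T A x: every undirected edge contributes
  twice.\<close>

definition quad_form :: "('a \<times> 'a) set \<Rightarrow> ('a \<Rightarrow> real) \<Rightarrow> real" where
  "quad_form R x = (\<Sum>(a, b)\<in>R. x a * x b)"

lemma sum_arcs:
  assumes "finite V" "R \<subseteq> V \<times> V"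
  shows "(\<Sum>(a, b)\<in>R. f a b) = (\<Sum>a\<in>V. \<Sum>b\<in>R `` {a}. f a b)"
proof -
  have "R = Sigma V (\<lambda>a. R `` {a})" using assms by auto
  moreover have "finite (R `` {a})" for a
    using assms by (meson finite_Image finite_SigmaI finite_subset)
  ultimately show ?thesis using assms(1) by (metis (no_types, lifting) sum.Sigma sum.cong)
qed

lemma sum_arcs_swap:
  assumes "sym R"
  shows "(\<Sum>(a, b)\<in>R. f a b) = (\<Sum>(a, b)\<in>R. f b a)"
  using assms by (intro sum.reindex_bij_witness[of _ prod.swap prod.swap]) (auto dest: symD)

lemma quad_form_add:
  assumes "finite V" "R \<subseteq> V \<times> V" "sym R"
  shows "quad_form R (\<lambda>v. x v + t * e v) =
    quad_form R x + 2 * t * (\<Sum>a\<in>V. e a * (\<Sum>b\<in>R `` {a}. x b)) + t\<^sup>2 * quad_form R e"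
proof -
  have "quad_form R (\<lambda>v. x v + t * e v) =
      quad_form R x + t * (\<Sum>(a, b)\<in>R. x a * e b) + t * (\<Sum>(a, b)\<in>R. e a * x b) + t\<^sup>2 * quad_form R e"
    unfolding quad_form_def sum_distrib_left
    by (simp add: sum.distrib[symmetric] algebra_simps power2_eq_square case_prod_unfold)
  also have "(\<Sum>(a, b)\<in>R. x a * e b) = (\<Sum>(a, b)\<in>R. e a * x b)"
    using sum_arcs_swap[OF assms(3), of "\<lambda>a b. x a * e b"] by (simp add: mult.commute)
  also have "(\<Sum>(a, b)\<in>R. e a * x b) = (\<Sum>a\<in>V. e a * (\<Sum>b\<in>R `` {a}. x b))"
    by (simp add: sum_arcs[OF assms(1,2)] sum_distrib_left)
  finally show ?thesis by (simp add: algebra_simps)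
qed

lemma quad_form_le_abs: "quad_form R x \<le> quad_form R (\<lambda>v. \<bar>x v\<bar>)"
  unfolding quad_form_def by (intro sum_mono) (auto simp flip: abs_mult)

text \<open>Passing to absolute values does not decrease the form, so it suffices to maximize over
  nonnegative functions of norm 1. Functions on the whole type with values in the unit interval are
  compact by Tychonoff, which avoids coordinates for \<open>V\<close>.\<close>

lemma quad_form_maximizer:
  fixes V :: "'a set"
  assumes V: "finite V" "V \<noteq> {}" and R: "R \<subseteq> V \<times> V"
  shows "\<exists>x. (\<forall>v. 0 \<le> x v) \<and> (\<Sum>v\<in>V. (x v)\<^sup>2) = 1 \<and>
    (\<forall>y. quad_form R y \<le> quad_form R x * (\<Sum>v\<in>V. (y v)\<^sup>2))"
proof -
  define K where "K = (PiE UNIV (\<lambda>_. {0..1})) \<inter> {x :: 'a \<Rightarrow> real. (\<Sum>v\<in>V. (x v)\<^sup>2) = 1}"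
  have coord: "continuous_on S (\<lambda>x :: 'a \<Rightarrow> real. x i)" for S i
    by (rule continuous_on_subset[OF continuous_on_product_coordinates]) simp
  have "compactin (product_topology (\<lambda>_. euclidean) UNIV) (PiE (UNIV :: 'a set) (\<lambda>_. {0..1::real}))"
    by (simp add: compactin_PiE)
  then have "compact (PiE (UNIV :: 'a set) (\<lambda>_. {0..1::real}))"
    by (simp add: euclidean_product_topology)
  moreover have "closed {x :: 'a \<Rightarrow> real. (\<Sum>v\<in>V. (x v)\<^sup>2) = 1}"
    by (intro closed_Collect_eq continuous_intros coord)
  ultimately have "compact K" unfolding K_def by (rule compact_Int_closed)
  moreover obtain v0 where v0: "v0 \<in> V" using V by blast
  have "(\<lambda>v. if v = v0 then 1 else 0) \<in> K"
    using V v0 by (simp add: K_def PiE_iff if_distrib[of "\<lambda>x. x\<^sup>2"] cong: if_cong)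
  then have "K \<noteq> {}" by blast
  moreover have "continuous_on K (quad_form R)"
    unfolding quad_form_def case_prod_unfold by (intro continuous_intros coord)
  ultimately obtain x where x: "x \<in> K" "\<And>y. y \<in> K \<Longrightarrow> quad_form R y \<le> quad_form R x"
    using continuous_attains_sup[of K "quad_form R"] by blast
  have "quad_form R y \<le> quad_form R x * (\<Sum>v\<in>V. (y v)\<^sup>2)" for y
  proof (cases "(\<Sum>v\<in>V. (y v)\<^sup>2) = 0")
    case True
    then have "y v = 0" if "v \<in> V" for v using that V by (simp add: sum_nonneg_eq_0_iff)
    then have "quad_form R y = 0" using R unfolding quad_form_def by (intro sum.neutral) auto
    then show ?thesis using True by simp
  next
    case False
    define s where "s = sqrt (\<Sum>v\<in>V. (y v)\<^sup>2)"
    have pos: "(\<Sum>v\<in>V. (y v)\<^sup>2) > 0" using False by (simp add: sum_nonneg order_less_le)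
    have s: "s > 0" "s\<^sup>2 = (\<Sum>v\<in>V. (y v)\<^sup>2)" using pos by (simp_all add: s_def)
    \<comment> \<open>The value 0 off \<open>V\<close> keeps \<open>z\<close> in \<open>K\<close>,
      whose bounds apply to the whole type; the form and the norm only see \<open>V\<close>.\<close>
    define z where "z = (\<lambda>v. if v \<in> V then \<bar>y v\<bar> / s else 0)"
    have sum1: "(\<Sum>v\<in>V. (z v)\<^sup>2) = 1"
      using s pos by (simp add: z_def power_divide flip: sum_divide_distrib)
    have "z v \<le> 1" for v
    proof (cases "v \<in> V")
      case True
      then have "(z v)\<^sup>2 \<le> 1" using sum1 member_le_sum[OF True, of "\<lambda>v. (z v)\<^sup>2"] V by simp
      then show ?thesis by (simp add: abs_square_le_1 flip: abs_le_square_iff) 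
    qed (simp add: z_def)
    moreover have "0 \<le> z v" for v using s by (simp add: z_def)
    ultimately have "z \<in> K" using sum1 by (auto simp: K_def)
    then have "quad_form R z \<le> quad_form R x" by (rule x(2))
    moreover have "quad_form R (\<lambda>v. \<bar>y v\<bar>) = s\<^sup>2 * quad_form R z"
      unfolding quad_form_def sum_distrib_left
      using R s(1) by (intro sum.cong) (auto simp: z_def power2_eq_square)
    ultimately show ?thesis using quad_form_le_abs[of R y] s
      by (smt (verit, best) mult.commute mult_left_mono zero_le_power2)
  qed
  then show ?thesis using x(1) by (intro exI[of _ x]) (auto simp: K_def)
qed

text \<open>First variation in the single coordinate \<open>a\<close>: the linear term of the
  perturbed quotient must vanish, and it is the defect of the eigenvalue equation at
  \<open>a\<close>. The unit vector at \<open>a\<close> has form 0 because there are no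
  loops.\<close>

lemma maximizer_eigenvector:
  assumes V: "finite V" and R: "R \<subseteq> V \<times> V" "sym R" "irrefl R"
    and x: "(\<Sum>v\<in>V. (x v)\<^sup>2) = 1" "\<And>v. 0 \<le> x v"
    and max: "\<And>y. quad_form R y \<le> quad_form R x * (\<Sum>v\<in>V. (y v)\<^sup>2)"
    and a: "a \<in> V"
  shows "(\<Sum>b\<in>R `` {a}. x b) = quad_form R x * x a"
proof (rule ccontr)
  define \<mu> where "\<mu> = quad_form R x"
  define c where "c = \<mu> * x a - (\<Sum>b\<in>R `` {a}. x b)"
  define e :: "'a \<Rightarrow> real" where "e = (\<lambda>v. if v = a then 1 else 0)"
  assume "\<not> ?thesis"
  then have c0: "c \<noteq> 0" by (simp add: c_def \<mu>_def)
  have mu0: "\<mu> \<ge> 0" unfolding \<mu>_def quad_form_def using x(2) by (intro sum_nonneg) auto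
  have qe: "quad_form R e = 0"
    unfolding quad_form_def e_def using R(3) by (intro sum.neutral) (auto simp: irrefl_def)
  have se: "(\<Sum>v\<in>V. e v * f v) = f a" for f :: "'a \<Rightarrow> real"
    using V a by (simp add: e_def if_distrib[of "\<lambda>z. z * _"] cong: if_cong)
  have *: "0 \<le> 2 * t * c + \<mu> * t\<^sup>2" for t
  proof -
    have "(\<Sum>v\<in>V. (x v + t * e v)\<^sup>2) = (\<Sum>v\<in>V. (x v)\<^sup>2) + 2 * t * (\<Sum>v\<in>V. e v * x v) + t\<^sup>2 * (\<Sum>v\<in>V. e v * e v)"
      by (simp add: sum_distrib_left sum.distrib[symmetric] power2_eq_square algebra_simps)
    also have "\<dots> = 1 + 2 * t * x a + t\<^sup>2" unfolding se x(1) by (simp add: e_def)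
    finally have "quad_form R (\<lambda>v. x v + t * e v) \<le> \<mu> * (1 + 2 * t * x a + t\<^sup>2)"
      using max[of "\<lambda>v. x v + t * e v"] by (simp add: \<mu>_def)
    then show ?thesis
      unfolding quad_form_add[OF V R(1,2)] se qe by (simp add: c_def \<mu>_def algebra_simps)
  qed
  \<comment> \<open>Dividing by \<mu> + 1 instead of \<mu> avoids a zero divisor and still turns the
    expression into \<open>- (t\<^sup>2 * (\<mu> + 2))\<close>, which is negative.\<close>
  define t where "t = - c / (\<mu> + 1)"
  have ct: "c = - (t * (\<mu> + 1))" using mu0 by (simp add: t_def)
  have "2 * t * c + \<mu> * t\<^sup>2 = - (t\<^sup>2 * (\<mu> + 2))"
    unfolding ct by (simp add: algebra_simps power2_eq_square)
  moreover have "t\<^sup>2 * (\<mu> + 2) > 0" using c0 mu0 by (simp add: t_def)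
  ultimately show False using *[of t] by simp
qed

section \<open>From the adjacency matrix to functions on the vertices\<close>

lemma vertex_enum_bij:
  assumes "finite (pverts G)"
  shows "bij_betw ((!) (vertex_enum G)) {..<card (pverts G)} (pverts G)"
proof -
  have "\<exists>vs. distinct vs \<and> set vs = pverts G" using finite_distinct_list[OF assms] by blast
  then have "distinct (vertex_enum G) \<and> set (vertex_enum G) = pverts G"
    unfolding vertex_enum_def by (rule someI_ex)
  then show ?thesis using bij_betw_nth[of "vertex_enum G"] by (metis distinct_card)
qed

lemma adjacency_matrix_mult:
  fixes x :: "'a \<Rightarrow> real"
  assumes "finite (pverts G)" "parcs G \<subseteq> pverts G \<times> pverts G" "i < card (pverts G)"
  shows "(adjacency_matrix G *\<^sub>v vec (card (pverts G)) (\<lambda>j. x (vertex_enum G ! j))) $ i =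
    (\<Sum>b\<in>parcs G `` {vertex_enum G ! i}. x b)"
proof -
  let ?n = "card (pverts G)" and ?e = "(!) (vertex_enum G)"
  have "(adjacency_matrix G *\<^sub>v vec ?n (\<lambda>j. x (?e j))) $ i =
      (\<Sum>j\<in>{..<?n}. if (?e i, ?e j) \<in> parcs G then x (?e j) else 0)"
    using assms(3) by (auto simp: adjacency_matrix_def scalar_prod_def lessThan_atLeast0 intro!: sum.cong)
  also have "\<dots> = (\<Sum>b\<in>pverts G. if (?e i, b) \<in> parcs G then x b else 0)"
    by (rule sum.reindex_bij_betw[OF vertex_enum_bij[OF assms(1)]])
  also have "\<dots> = (\<Sum>b\<in>parcs G `` {?e i}. x b)"
    using assms(1,2) by (intro sum.mono_neutral_cong_right) auto
  finally show ?thesis .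
qed

text \<open>The maximal Rayleigh quotient is an eigenvalue by the first variation, and every
  eigenvalue is the quotient of its eigenvector, so the maximum of both is the same. The maximizer
  provides a nonnegative eigenvector.\<close>

theorem graph_spectral_radius_eigenvector:
  assumes V: "finite (pverts G)" "pverts G \<noteq> {}"
    and R: "parcs G \<subseteq> pverts G \<times> pverts G" "sym (parcs G)" "irrefl (parcs G)"
  shows "\<exists>x. (\<forall>v. 0 \<le> x v) \<and> (\<exists>v\<in>pverts G. x v \<noteq> 0) \<and>
      (\<forall>a\<in>pverts G. (\<Sum>b\<in>parcs G `` {a}. x b) = graph_spectral_radius G * x a)"
    and "quad_form (parcs G) y \<le> graph_spectral_radius G * (\<Sum>v\<in>pverts G. (y v)\<^sup>2)"
proof -
  let ?n = "card (pverts G)" and ?e = "(!) (vertex_enum G)" and ?A = "adjacency_matrix G"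
  note bij = vertex_enum_bij[OF V(1)]
  have dim: "?A \<in> carrier_mat ?n ?n" by (simp add: adjacency_matrix_def)
  obtain x where x: "\<And>v. 0 \<le> x v" "(\<Sum>v\<in>pverts G. (x v)\<^sup>2) = 1"
    and max: "\<And>y. quad_form (parcs G) y \<le> quad_form (parcs G) x * (\<Sum>v\<in>pverts G. (y v)\<^sup>2)"
    using quad_form_maximizer[OF V R(1)] by metis
  let ?\<mu> = "quad_form (parcs G) x"
  have eig: "(\<Sum>b\<in>parcs G `` {a}. x b) = ?\<mu> * x a" if "a \<in> pverts G" for a
    using maximizer_eigenvector[OF V(1) R x(2,1) max that] by blast
  have nz: "\<exists>v\<in>pverts G. x v \<noteq> 0" by (rule ccontr) (use x(2) in simp)
  have ex: "\<exists>i<?n. ?e i = v" if "v \<in> pverts G" for v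
    using bij_betw_imp_surj_on[OF bij] that by (metis imageE lessThan_iff)
  have mem: "?e i \<in> pverts G" if "i < ?n" for i using bij that by (auto simp: bij_betw_def)
  have "eigenvalue ?A ?\<mu>"
  proof -
    let ?v = "vec ?n (\<lambda>j. x (?e j))"
    have "?A *\<^sub>v ?v = ?\<mu> \<cdot>\<^sub>v ?v"
    proof (rule eq_vecI)
      fix i assume "i < dim_vec (?\<mu> \<cdot>\<^sub>v ?v)"
      then have i: "i < ?n" by simp
      have "(?A *\<^sub>v ?v) $ i = ?\<mu> * x (?e i)"
        unfolding adjacency_matrix_mult[OF V(1) R(1) i] by (rule eig[OF mem[OF i]])
      then show "(?A *\<^sub>v ?v) $ i = (?\<mu> \<cdot>\<^sub>v ?v) $ i" using i by simp
    qed (use dim in simp)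
    moreover have "?v \<noteq> 0\<^sub>v ?n"
    proof
      assume v0: "?v = 0\<^sub>v ?n"
      obtain v where v: "v \<in> pverts G" "x v \<noteq> 0" using nz by blast
      then obtain i where "i < ?n" "?e i = v" using ex by blast
      then show False using arg_cong[OF v0, of "\<lambda>w. w $ i"] v by simp
    qed
    ultimately show ?thesis using dim unfolding eigenvalue_def eigenvector_def by (intro exI[of _ ?v]) auto
  qed
  moreover have "k \<le> ?\<mu>" if ev: "eigenvalue ?A k" for k
  proof -
    obtain w where w: "w \<in> carrier_vec ?n" "w \<noteq> 0\<^sub>v ?n" "?A *\<^sub>v w = k \<cdot>\<^sub>v w"
      using ev dim unfolding eigenvalue_def eigenvector_def by auto
    define y where "y = (\<lambda>a. w $ (inv_into {..<?n} ?e a))"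
    have ye: "y (?e i) = w $ i" if "i < ?n" for i
      using bij that unfolding y_def by (subst inv_into_f_f) (auto simp: bij_betw_def)
    have wy: "w = vec ?n (\<lambda>j. y (?e j))" using w(1) ye by (intro eq_vecI) auto
    have "(\<Sum>b\<in>parcs G `` {a}. y b) = k * y a" if a: "a \<in> pverts G" for a
    proof -
      obtain i where i: "i < ?n" "a = ?e i" using ex[OF a] by blast
      have "(\<Sum>b\<in>parcs G `` {a}. y b) = (?A *\<^sub>v w) $ i"
        unfolding i(2) adjacency_matrix_mult[OF V(1) R(1) i(1), symmetric] wy[symmetric] ..
      then show ?thesis using i w(1) ye by (simp add: w(3))
    qed
    then have "quad_form (parcs G) y = k * (\<Sum>v\<in>pverts G. (y v)\<^sup>2)"
      unfolding quad_form_def sum_arcs[OF V(1) R(1)]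
      by (simp add: sum_distrib_left power2_eq_square flip: sum_distrib_left) (simp add: sum_distrib_left algebra_simps)
    moreover have "(\<Sum>v\<in>pverts G. (y v)\<^sup>2) > 0"
    proof -
      obtain i where i: "i < ?n" "w $ i \<noteq> 0" using w(1,2) by (metis carrier_vecD eq_vecI index_zero_vec)
      then show ?thesis using V mem ye by (intro sum_pos2[of _ "?e i"]) auto
    qed
    ultimately show ?thesis using max[of y] by simp
  qed
  moreover have "finite {k. eigenvalue ?A k}"
  proof -
    have "char_poly ?A \<noteq> 0" using degree_monic_char_poly[OF dim] by auto
    then show ?thesis using poly_roots_finite eigenvalue_root_char_poly[OF dim] by auto
  qed
  ultimately have rho: "graph_spectral_radius G = ?\<mu>"
    unfolding graph_spectral_radius_def by (intro Max_eqI) auto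
  show "\<exists>x. (\<forall>v. 0 \<le> x v) \<and> (\<exists>v\<in>pverts G. x v \<noteq> 0) \<and>
      (\<forall>a\<in>pverts G. (\<Sum>b\<in>parcs G `` {a}. x b) = graph_spectral_radius G * x a)"
    unfolding rho using x(1) nz eig by blast
  show "quad_form (parcs G) y \<le> graph_spectral_radius G * (\<Sum>v\<in>pverts G. (y v)\<^sup>2)"
    unfolding rho by (rule max)
qed

section \<open>The extremal graph\<close>

definition extremal_graph :: "nat \<Rightarrow> (nat + nat) pair_pre_digraph" where
  "extremal_graph k = graph_join (path_graph 2) (path_graph k)"

lemma extremal_verts: "pverts (extremal_graph k) = {Inl 0, Inl 1} \<union> Inr ` {..<k}"
proof -
  have "{..<2::nat} = {0, 1}" by auto
  then show ?thesis by (auto simp: extremal_graph_def graph_join_def path_graph_def)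
qed

text \<open>Written as pairwise disjoint images of index sets, so that sums over the arcs split and
  reindex. The path has \<open>k - 1\<close> edges.\<close>

lemma extremal_arcs: "parcs (extremal_graph k) =
    {(Inl 0, Inl 1), (Inl 1, Inl 0)} \<union>
    ((\<lambda>(h, i). (Inl h, Inr i)) ` ({0, 1} \<times> {..<k}) \<union> (\<lambda>(h, i). (Inr i, Inl h)) ` ({0, 1} \<times> {..<k})) \<union>
    ((\<lambda>i. (Inr i, Inr (Suc i))) ` {..<k - 1} \<union> (\<lambda>i. (Inr (Suc i), Inr i)) ` {..<k - 1})"
proof -
  have two: "{..<2::nat} = {0, 1}" by auto
  have hub: "{(i::nat, j). i < 2 \<and> j < 2 \<and> (j = Suc i \<or> i = Suc j)} = {(0, 1), (1, 0)}"
    by (auto simp: less_2_cases_iff)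
  have path: "{(i, j). i < k \<and> j < k \<and> (j = Suc i \<or> i = Suc j)} =
      (\<lambda>i. (i, Suc i)) ` {..<k - 1} \<union> (\<lambda>i. (Suc i, i)) ` {..<k - 1}"
    by (auto simp: image_iff)
  show ?thesis
    unfolding extremal_graph_def graph_join_def path_graph_def pair_pre_digraph.simps hub path
    using two by auto
qed

lemma extremal_sym: "sym (parcs (extremal_graph k))"
  unfolding extremal_arcs sym_def by auto

lemma extremal_irrefl: "irrefl (parcs (extremal_graph k))"
  unfolding extremal_arcs irrefl_def by auto

lemma extremal_wf: "parcs (extremal_graph k) \<subseteq> pverts (extremal_graph k) \<times> pverts (extremal_graph k)"
  unfolding extremal_arcs extremal_verts by (intro Un_least image_subsetI) auto

lemma extremal_finite: "finite (pverts (extremal_graph k))"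
  unfolding extremal_verts by simp

lemma extremal_card: "card (pverts (extremal_graph k)) = k + 2"
proof -
  have "card (Inr ` {..<k} :: (nat + nat) set) = k" by (simp add: card_image inj_on_def)
  then show ?thesis unfolding extremal_verts by (subst card_Un_disjoint) auto
qed

lemma extremal_pair_graph: "pair_graph (extremal_graph k)"
proof
  show "finite (parcs (extremal_graph k))" unfolding extremal_arcs by simp
  show "symmetric (with_proj (extremal_graph k))"
    using extremal_sym by (simp add: symmetric_def)
qed (use extremal_wf[of k] extremal_irrefl[of k] extremal_finite[of k] in \<open>auto simp: irrefl_def\<close>)

lemma extremal_dominating: "dominating_vertex (extremal_graph k) (Inl 0)"
  unfolding dominating_vertex_iff[OF extremal_pair_graph]
  by (auto simp: extremal_verts extremal_arcs)

lemma extremal_norm: "(\<Sum>v\<in>pverts (extremal_graph k). f v) = f (Inl 0) + f (Inl 1) + (\<Sum>i<k. f (Inr i) :: real)"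
  unfolding extremal_verts
  by (subst sum.union_disjoint) (auto simp: sum.reindex inj_on_def)

lemma extremal_quad_form:
  "quad_form (parcs (extremal_graph k)) x =
    2 * (x (Inl 0) * x (Inl 1) + (x (Inl 0) + x (Inl 1)) * (\<Sum>i<k. x (Inr i)) +
      (\<Sum>i<k - 1. x (Inr i) * x (Inr (Suc i))))"
proof -
  let ?f = "\<lambda>(a, b). x a * x b"
  let ?H = "{(Inl 0, Inl 1), (Inl 1, Inl 0)} :: ((nat + nat) \<times> (nat + nat)) set"
  let ?S = "(\<lambda>(h, i). (Inl h, Inr i)) ` ({0, 1} \<times> {..<k}) :: ((nat + nat) \<times> (nat + nat)) set"
  let ?S' = "(\<lambda>(h, i). (Inr i, Inl h)) ` ({0, 1} \<times> {..<k}) :: ((nat + nat) \<times> (nat + nat)) set"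
  let ?P = "(\<lambda>i. (Inr i, Inr (Suc i))) ` {..<k - 1} :: ((nat + nat) \<times> (nat + nat)) set"
  let ?P' = "(\<lambda>i. (Inr (Suc i), Inr i)) ` {..<k - 1} :: ((nat + nat) \<times> (nat + nat)) set"
  have S: "sum ?f ?S = (\<Sum>h\<in>{0, 1}. \<Sum>i<k. x (Inl h) * x (Inr i))"
    by (subst sum.reindex) (auto simp: inj_on_def sum.cartesian_product case_prod_unfold)
  have S': "sum ?f ?S' = (\<Sum>h\<in>{0, 1}. \<Sum>i<k. x (Inr i) * x (Inl h))"
    by (subst sum.reindex) (auto simp: inj_on_def sum.cartesian_product case_prod_unfold)
  have P: "sum ?f ?P = (\<Sum>i<k - 1. x (Inr i) * x (Inr (Suc i)))"
    by (subst sum.reindex) (auto simp: inj_on_def)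
  have P': "sum ?f ?P' = (\<Sum>i<k - 1. x (Inr (Suc i)) * x (Inr i))"
    by (subst sum.reindex) (auto simp: inj_on_def)
  have "quad_form (parcs (extremal_graph k)) x = sum ?f ?H + (sum ?f ?S + sum ?f ?S') + (sum ?f ?P + sum ?f ?P')"
    unfolding quad_form_def extremal_arcs
    by (subst sum.union_disjoint; (subst sum.union_disjoint)?; (subst sum.union_disjoint)?; (subst sum.union_disjoint)?; force?)+
  also have "sum ?f ?H = 2 * (x (Inl 0) * x (Inl 1))" by simp
  finally show ?thesis unfolding S S' P P'
    by (simp add: sum_distrib_left algebra_simps)
qed

section \<open>A straight-line drawing: hubs at i and -i, the path on the positive real axis\<close>

fun position :: "nat + nat \<Rightarrow> complex" where
  "position (Inl h) = Complex 0 (if h = 0 then 1 else -1)"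
| "position (Inr i) = Complex (real i + 1) 0"

text \<open>A drawing is indexed by unordered pairs, so one of the two directions of the segment is
  chosen arbitrarily; all later facts are symmetric in it.\<close>

definition segment_path :: "(nat + nat) set \<Rightarrow> real \<Rightarrow> complex" where
  "segment_path S = (SOME g. \<exists>a b. S = {a, b} \<and> g = linepath (position a) (position b))"

lemma segment_path:
  "segment_path {a, b} = linepath (position a) (position b) \<or> segment_path {a, b} = linepath (position b) (position a)"
proof -
  have "\<exists>g a' b'. {a, b} = {a', b'} \<and> g = linepath (position a') (position b')" by blast
  from someI_ex[OF this]
  have "\<exists>a' b'. {a, b} = {a', b'} \<and> segment_path {a, b} = linepath (position a') (position b')"
    unfolding segment_path_def .
  then show ?thesis by (auto simp: doubleton_eq_iff)
qed

lemma segment_image: "path_image (segment_path {a, b}) = closed_segment (position a) (position b)"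
  using segment_path[of a b] by (auto simp: closed_segment_commute)

lemma hub_segment: "path_image (segment_path {Inl 0, Inl 1}) = {z. Re z = 0 \<and> \<bar>Im z\<bar> \<le> 1}"
proof -
  have "z \<in> closed_segment (Complex 0 1) (Complex 0 (-1)) \<longleftrightarrow> Re z = 0 \<and> \<bar>Im z\<bar> \<le> 1" for z
  proof
    assume z: "Re z = 0 \<and> \<bar>Im z\<bar> \<le> 1"
    then show "z \<in> closed_segment (Complex 0 1) (Complex 0 (-1))"
      unfolding in_segment
      by (intro exI[of _ "(1 - Im z) / 2"]) (auto simp: complex_eq_iff field_simps)
  qed (auto simp: in_segment)
  then show ?thesis unfolding segment_image by auto
qed

text \<open>The line equation is cleared of denominators, so that intersections of spokes reduce to
  linear algebra.\<close>

lemma spoke_segment: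
  assumes "h \<in> {0, 1}"
  shows "path_image (segment_path {Inl h, Inr i}) =
    {z. 0 \<le> Re z \<and> Re z \<le> real i + 1 \<and> (real i + 1) * Im z = (if h = 0 then 1 else -1) * (real i + 1 - Re z)}"
proof -
  define s :: real where "s = (if h = 0 then 1 else -1)"
  define r where "r = real i + 1"
  have r: "r > 0" by (simp add: r_def)
  have "z \<in> closed_segment (Complex 0 s) (Complex r 0) \<longleftrightarrow> 0 \<le> Re z \<and> Re z \<le> r \<and> r * Im z = s * (r - Re z)" for z
  proof
    assume z: "0 \<le> Re z \<and> Re z \<le> r \<and> r * Im z = s * (r - Re z)"
    then have "Im z = s * (1 - Re z / r)" using r by (simp add: field_simps)
    then show "z \<in> closed_segment (Complex 0 s) (Complex r 0)"
      unfolding in_segment using r z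
      by (intro exI[of _ "Re z / r"]) (auto simp: complex_eq_iff)
  next
    assume "z \<in> closed_segment (Complex 0 s) (Complex r 0)"
    then obtain u where "0 \<le> u" "u \<le> 1" "z = (1 - u) *\<^sub>R Complex 0 s + u *\<^sub>R Complex r 0"
      by (auto simp: in_segment)
    then have "Re z = u * r" "Im z = (1 - u) * s" by auto
    then show "0 \<le> Re z \<and> Re z \<le> r \<and> r * Im z = s * (r - Re z)"
      using r \<open>0 \<le> u\<close> \<open>u \<le> 1\<close> by (simp only:) (auto simp: mult_left_le_one_le algebra_simps)
  qed
  moreover have "position (Inl h) = Complex 0 s" "position (Inr i) = Complex r 0"
    by (simp_all add: r_def s_def)
  ultimately show ?thesis unfolding segment_image s_def[symmetric] r_def[symmetric] by (simp only: set_eq_iff mem_Collect_eq simp_thms)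
qed

lemma rim_segment:
  "path_image (segment_path {Inr i, Inr (Suc i)}) = {z. Im z = 0 \<and> real i + 1 \<le> Re z \<and> Re z \<le> real i + 2}"
proof -
  define r where "r = real i + 1"
  have "z \<in> closed_segment (Complex r 0) (Complex (r + 1) 0) \<longleftrightarrow> Im z = 0 \<and> r \<le> Re z \<and> Re z \<le> r + 1" for z
  proof
    assume z: "Im z = 0 \<and> r \<le> Re z \<and> Re z \<le> r + 1"
    then show "z \<in> closed_segment (Complex r 0) (Complex (r + 1) 0)"
      unfolding in_segment by (intro exI[of _ "Re z - r"]) (auto simp: complex_eq_iff algebra_simps)
  next
    assume "z \<in> closed_segment (Complex r 0) (Complex (r + 1) 0)"
    then obtain u where "0 \<le> u" "u \<le> 1" "z = (1 - u) *\<^sub>R Complex r 0 + u *\<^sub>R Complex (r + 1) 0"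
      by (auto simp: in_segment)
    then have "Im z = 0" "Re z = (1 - u) * r + u * (r + 1)" by auto
    then show "Im z = 0 \<and> r \<le> Re z \<and> Re z \<le> r + 1"
      using \<open>0 \<le> u\<close> \<open>u \<le> 1\<close> by (simp add: algebra_simps)
  qed
  moreover have "position (Inr i) = Complex r 0" "position (Inr (Suc i)) = Complex (r + 1) 0"
    by (simp_all add: r_def)
  moreover have "real i + 1 = r" "real i + 2 = r + 1" by (simp_all add: r_def)
  ultimately show ?thesis unfolding segment_image by (simp only: set_eq_iff mem_Collect_eq simp_thms)
qed

lemma extremal_edge_cases:
  assumes "(a, b) \<in> parcs (extremal_graph k)"
  obtains "{a, b} = {Inl 0, Inl 1}"
  | h i where "h \<in> {0, 1}" "i < k" "{a, b} = {Inl h, Inr i}"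
  | i where "Suc i < k" "{a, b} = {Inr i, Inr (Suc i)}"
proof -
  have "(a, b) \<in> {(Inl 0, Inl 1), (Inl 1, Inl 0)} \<or>
    (\<exists>h i. h \<in> {0, 1} \<and> i < k \<and> (a, b) \<in> {(Inl h, Inr i), (Inr i, Inl h)}) \<or>
    (\<exists>i. i < k - 1 \<and> (a, b) \<in> {(Inr i, Inr (Suc i)), (Inr (Suc i), Inr i)})"
    using assms unfolding extremal_arcs by (elim UnE imageE) auto
  then consider "(a, b) \<in> {(Inl 0, Inl 1), (Inl 1, Inl 0)}"
    | h i where "h \<in> {0, 1}" "i < k" "(a, b) \<in> {(Inl h, Inr i), (Inr i, Inl h)}"
    | i where "i < k - 1" "(a, b) \<in> {(Inr i, Inr (Suc i)), (Inr (Suc i), Inr i)}"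
    by metis
  then show thesis
  proof cases
    case 1 then show ?thesis using that(1) by (auto simp: insert_commute)
  next
    case 2 then show ?thesis using that(2)[of h i] by (auto simp: insert_commute)
  next
    case 3 then show ?thesis using that(3)[of i] by (auto simp: insert_commute)
  qed
qed

definition meets_properly :: "(nat + nat) set \<Rightarrow> (nat + nat) set \<Rightarrow> bool" where
  "meets_properly S T \<longleftrightarrow> path_image (segment_path S) \<inter> path_image (segment_path T) \<subseteq> position ` (S \<inter> T)"

lemma meets_properly_sym: "meets_properly S T \<Longrightarrow> meets_properly T S"
  by (simp add: meets_properly_def Int_commute)

text \<open>Spokes of the two hubs lie in opposite closed half planes and can meet only on the real
  axis.\<close>

lemma spoke_height:
  assumes "0 \<le> Re z" "Re z \<le> real i + 1" "(real i + 1) * Im z = s * (real i + 1 - Re z)" "s \<in> {1, -1 :: real}"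
  shows "0 \<le> s * Im z"
proof -
  have "(real i + 1) * (s * Im z) = s * (s * (real i + 1 - Re z))"
    using assms(3) by (metis mult.left_commute)
  also have "\<dots> \<ge> 0" using assms by auto
  finally show ?thesis by (simp add: zero_le_mult_iff)
qed

lemma extremal_meets_properly:
  "h \<in> {0, 1} \<Longrightarrow> meets_properly {Inl 0, Inl 1} {Inl h, Inr i}"
  "meets_properly {Inl 0, Inl 1} {Inr i, Inr (Suc i)}"
  "h \<in> {0, 1} \<Longrightarrow> h' \<in> {0, 1} \<Longrightarrow> {Inl h, Inr i} \<noteq> {Inl h', Inr j :: nat + nat} \<Longrightarrow>
    meets_properly {Inl h, Inr i} {Inl h', Inr j}"
  "h \<in> {0, 1} \<Longrightarrow> meets_properly {Inl h, Inr i} {Inr j, Inr (Suc j)}"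
  "i < j \<Longrightarrow> meets_properly {Inr i, Inr (Suc i)} {Inr j, Inr (Suc j)}"
proof -
  show "meets_properly {Inl 0, Inl 1} {Inl h, Inr i}" if h: "h \<in> {0, 1}"
    unfolding meets_properly_def hub_segment spoke_segment[OF h]
  proof
    fix z assume z: "z \<in> {z. Re z = 0 \<and> \<bar>Im z\<bar> \<le> 1} \<inter>
      {z. 0 \<le> Re z \<and> Re z \<le> real i + 1 \<and> (real i + 1) * Im z = (if h = 0 then 1 else -1) * (real i + 1 - Re z)}"
    then have "(real i + 1) * Im z = (real i + 1) * (if h = 0 then 1 else -1)" "Re z = 0" by auto
    then have "z = position (Inl h)" by (simp add: complex_eq_iff)
    then show "z \<in> position ` ({Inl 0, Inl 1} \<inter> {Inl h, Inr i})"
        using h by (intro image_eqI[of _ _ "Inl h"]) auto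
  qed
  show "meets_properly {Inl 0, Inl 1} {Inr i, Inr (Suc i)}"
    unfolding meets_properly_def hub_segment rim_segment by auto
  show "meets_properly {Inl h, Inr i} {Inl h', Inr j}"
    if h: "h \<in> {0, 1}" "h' \<in> {0, 1}" and ne: "{Inl h, Inr i} \<noteq> {Inl h', Inr j :: nat + nat}"
    unfolding meets_properly_def spoke_segment[OF h(1)] spoke_segment[OF h(2)]
  proof
    define s s' :: real where "s = (if h = 0 then 1 else -1)" and "s' = (if h' = 0 then 1 else -1)"
    fix z assume "z \<in> {z. 0 \<le> Re z \<and> Re z \<le> real i + 1 \<and> (real i + 1) * Im z = (if h = 0 then 1 else -1) * (real i + 1 - Re z)} \<inter>
      {z. 0 \<le> Re z \<and> Re z \<le> real j + 1 \<and> (real j + 1) * Im z = (if h' = 0 then 1 else -1) * (real j + 1 - Re z)}"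
    then have z: "0 \<le> Re z" "Re z \<le> real i + 1" "(real i + 1) * Im z = s * (real i + 1 - Re z)"
      "Re z \<le> real j + 1" "(real j + 1) * Im z = s' * (real j + 1 - Re z)" by (auto simp: s_def s'_def)
    show "z \<in> position ` ({Inl h, Inr i} \<inter> {Inl h', Inr j})"
    proof (cases "h = h'")
      case True
      then have ij: "i \<noteq> j" and "s' = s" using ne by (auto simp: s_def s'_def)
      have "(real j + 1) * (s * (real i + 1 - Re z)) = (real i + 1) * (s * (real j + 1 - Re z))"
        using z(3,5) \<open>s' = s\<close> by (metis mult.left_commute)
      \<comment> \<open>Eliminating \<open>Im z\<close> from the two line equations: distinct spokes
        of one hub meet only where \<open>Re z = 0\<close>, at the hub.\<close>
      then have "s * Re z * (real i - real j) = 0" by (simp add: algebra_simps)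
      then have "Re z = 0" using ij by (auto simp: s_def split: if_splits)
      then have "(real i + 1) * Im z = (real i + 1) * s" using z(3) by simp
      then have "Im z = s" by simp
      then have "z = position (Inl h)" using \<open>Re z = 0\<close> by (simp add: complex_eq_iff s_def)
      then show ?thesis using True by (intro image_eqI[of _ _ "Inl h"]) auto
    next
      case False
      then have "s' = - s" "s \<in> {1, -1}" "s' \<in> {1, -1}" using h by (auto simp: s_def s'_def)
      then have "Im z = 0"
        using spoke_height[OF z(1,2,3)] spoke_height[OF z(1,4,5)] by auto
      then have "Re z = real i + 1" "Re z = real j + 1" using z(3,5) \<open>s \<in> {1, -1}\<close> \<open>s' \<in> {1, -1}\<close> by auto
      then have "i = j" "z = position (Inr i)" using \<open>Im z = 0\<close> by (auto simp: complex_eq_iff)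
      then show ?thesis by (intro image_eqI[of _ _ "Inr i"]) auto
    qed
  qed
  show "meets_properly {Inl h, Inr i} {Inr j, Inr (Suc j)}" if h: "h \<in> {0, 1}"
    unfolding meets_properly_def spoke_segment[OF h] rim_segment
  proof
    fix z assume "z \<in> {z. 0 \<le> Re z \<and> Re z \<le> real i + 1 \<and> (real i + 1) * Im z = (if h = 0 then 1 else -1) * (real i + 1 - Re z)} \<inter>
      {z. Im z = 0 \<and> real j + 1 \<le> Re z \<and> Re z \<le> real j + 2}"
    then have z: "Im z = 0" "Re z = real i + 1" "real j + 1 \<le> Re z" "Re z \<le> real j + 2" by (auto split: if_splits)
    then have "real j \<le> real i" "real i \<le> real (Suc j)" by auto
    then have "i = j \<or> i = Suc j" by linarith
    moreover have "z = position (Inr i)" using z by (auto simp: complex_eq_iff)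
    ultimately show "z \<in> position ` ({Inl h, Inr i} \<inter> {Inr j, Inr (Suc j)})"
      by (intro image_eqI[of _ _ "Inr i"]) auto
  qed
  show "meets_properly {Inr i, Inr (Suc i)} {Inr j, Inr (Suc j)}" if ij: "i < j"
    unfolding meets_properly_def rim_segment
  proof
    fix z assume z: "z \<in> {z. Im z = 0 \<and> real i + 1 \<le> Re z \<and> Re z \<le> real i + 2} \<inter>
      {z. Im z = 0 \<and> real j + 1 \<le> Re z \<and> Re z \<le> real j + 2}"
    then have "j = Suc i" using ij by auto
    moreover from this have "z = position (Inr j)" using z by (auto simp: complex_eq_iff)
    ultimately show "z \<in> position ` ({Inr i, Inr (Suc i)} \<inter> {Inr j, Inr (Suc j)})"
      by (intro image_eqI[of _ _ "Inr j"]) auto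
  qed
qed

lemma position_eq_iff:
  assumes "a \<in> pverts (extremal_graph k)" "b \<in> pverts (extremal_graph k)"
  shows "position a = position b \<longleftrightarrow> a = b"
  using assms unfolding extremal_verts by (auto simp: complex_eq_iff)

lemma extremal_planar: "planar (extremal_graph k)"
proof -
  let ?G = "extremal_graph k"
  have arcs: "Path_Connected.arc (segment_path {a, b}) \<and>
      {pathstart (segment_path {a, b}), pathfinish (segment_path {a, b})} = {position a, position b} \<and>
      path_image (segment_path {a, b}) \<inter> position ` pverts ?G \<subseteq> {position a, position b}"
    if ab: "(a, b) \<in> parcs ?G" for a b
  proof -
    have v: "a \<in> pverts ?G" "b \<in> pverts ?G" "a \<noteq> b"
      using ab extremal_wf extremal_irrefl by (auto simp: irrefl_def)
    have "position a \<noteq> position b" using position_eq_iff[OF v(1,2)] v(3) by simp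
    then have 1: "Path_Connected.arc (segment_path {a, b}) \<and>
      {pathstart (segment_path {a, b}), pathfinish (segment_path {a, b})} = {position a, position b}"
      using segment_path[of a b] by (auto simp: arc_linepath)
    have "position w \<in> position ` {a, b}" if "w \<in> pverts ?G" "position w \<in> path_image (segment_path {a, b})" for w
      using ab
    proof (cases rule: extremal_edge_cases)
      case 1
      then show ?thesis using that unfolding 1 hub_segment extremal_verts by auto
    next
      case (2 h i)
      then show ?thesis using that unfolding 2(3) spoke_segment[OF 2(1)] extremal_verts
        by (auto simp: complex_eq_iff split: if_splits)
    next
      case (3 i)
      then show ?thesis using that unfolding 3(2) rim_segment extremal_verts
        by (auto simp: complex_eq_iff)
    qed
    then show ?thesis using 1 by auto
  qed
  have meets: "meets_properly {a, b} {x, y}"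
    if ab: "(a, b) \<in> parcs ?G" and xy: "(x, y) \<in> parcs ?G" and ne: "{a, b} \<noteq> {x, y}" for a b x y
    using ab
  proof (cases rule: extremal_edge_cases)
    case 1
    show ?thesis using xy
    proof (cases rule: extremal_edge_cases)
      case 1 then show ?thesis using ne \<open>{a, b} = {Inl 0, Inl 1}\<close> by simp
    next
      case (2 h i) then show ?thesis using extremal_meets_properly(1) 1 by simp
    next
      case (3 i) then show ?thesis using extremal_meets_properly(2) 1 by simp
    qed
  next
    case (2 h i)
    show ?thesis using xy
    proof (cases rule: extremal_edge_cases)
      case 1 then show ?thesis using meets_properly_sym[OF extremal_meets_properly(1)] 2 by simp
    next
      case (2 h' i') 
      then show ?thesis using extremal_meets_properly(3)[OF \<open>h \<in> {0, 1}\<close> \<open>h' \<in> {0, 1}\<close>, of i i'] ne \<open>{a, b} = {Inl h, Inr i}\<close> by simp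
    next
      case (3 i') then show ?thesis using extremal_meets_properly(4)[OF \<open>h \<in> {0, 1}\<close>] 2 by simp
    qed
  next
    case (3 i)
    show ?thesis using xy
    proof (cases rule: extremal_edge_cases)
      case 1 then show ?thesis using meets_properly_sym[OF extremal_meets_properly(2)] 3 by simp
    next
      case (2 h' i') then show ?thesis using meets_properly_sym[OF extremal_meets_properly(4)] 3 by simp
    next
      case 4: (3 i')
      then have "i < i' \<or> i' < i" using ne 3 by (cases i i' rule: linorder_cases) auto
      then show ?thesis
        using extremal_meets_properly(5)[of i i'] meets_properly_sym[OF extremal_meets_properly(5)[of i' i]] 3 4 by auto
    qed
  qed
  have "inj_on position (pverts ?G)" using position_eq_iff by (auto simp: inj_on_def)
  moreover have "\<forall>e\<in>parcs ?G. \<forall>e'\<in>parcs ?G. {fst e, snd e} \<noteq> {fst e', snd e'} \<longrightarrow>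
      meets_properly {fst e, snd e} {fst e', snd e'}"
    using meets by (intro ballI impI) simp
  moreover have "\<forall>e\<in>parcs ?G. Path_Connected.arc (segment_path {fst e, snd e}) \<and>
      {pathstart (segment_path {fst e, snd e}), pathfinish (segment_path {fst e, snd e})} = {position (fst e), position (snd e)} \<and>
      path_image (segment_path {fst e, snd e}) \<inter> position ` pverts ?G \<subseteq> {position (fst e), position (snd e)}"
    by (intro ballI arcs) simp
  ultimately have "plane_drawing ?G position segment_path"
    unfolding plane_drawing_def meets_properly_def case_prod_unfold by (intro conjI)
  then show ?thesis unfolding planar_def by blast
qed

section \<open>Lower bounds for the extremal graph from vectors constant on the hubs and on the
  path\<close>

lemma extremal_test_vector:
  assumes "k > 0"
  shows "2 * (1 + 2 * real k * c + (real k - 1) * c\<^sup>2) \<le>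
    graph_spectral_radius (extremal_graph k) * (2 + real k * c\<^sup>2)"
proof -
  define y :: "nat + nat \<Rightarrow> real" where "y = case_sum (\<lambda>_. 1) (\<lambda>_. c)"
  have "quad_form (parcs (extremal_graph k)) y \<le>
      graph_spectral_radius (extremal_graph k) * (\<Sum>v\<in>pverts (extremal_graph k). (y v)\<^sup>2)"
    by (intro graph_spectral_radius_eigenvector(2) extremal_finite extremal_wf extremal_sym extremal_irrefl)
      (simp add: extremal_verts)
  then show ?thesis
    using assms unfolding extremal_quad_form extremal_norm by (simp add: y_def power2_eq_square algebra_simps of_nat_diff)
qed

text \<open>The test vector is used twice: a fixed value on the path gives a crude bound, which
  controls the error term when the value is then adapted to \<open>r\<close>.\<close>

lemma extremal_lower_bound:
  assumes k: "k \<ge> 46"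
  defines "r \<equiv> graph_spectral_radius (extremal_graph k)"
  shows "r \<ge> 10" "r\<^sup>2 - 3 * r \<ge> 2 * real k - 5 / 2"
proof -
  have k0: "k > 0" "real k \<ge> 46" using k by auto
  have "2 * (1 + 2 * real k * (1/4) + (real k - 1) * (1/4)\<^sup>2) \<le> r * (2 + real k * (1/4)\<^sup>2)"
    unfolding r_def by (rule extremal_test_vector[OF k0(1)])
  then have *: "16 * (2 + real k) + 2 * (real k - 1) \<le> r * (32 + real k)"
    by (simp add: power2_eq_square field_simps)
  show r10: "r \<ge> 10"
  proof (rule ccontr)
    assume "\<not> ?thesis"
    then have "r * (32 + real k) \<le> 10 * (32 + real k)" by (intro mult_right_mono) auto
    then show False using * k0 by simp
  qed
  \<comment> \<open>This choice maximizes \<open>c * (4 - c * (r - 2))\<close>, the factor of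
    \<open>real k\<close> in the test inequality. The bound \<open>r \<ge> 10\<close> gives
    \<open>c \<le> 1 / 4\<close>, so the error \<open>2 * c\<close> is at most 1/2.\<close>
  define c where "c = 2 / (r - 2)"
  have c: "c > 0" "c \<le> 1 / 4" "c * (r - 2) = 2" using r10 by (auto simp: c_def field_simps)
  have "2 * (1 + 2 * real k * c + (real k - 1) * c\<^sup>2) \<le> r * (2 + real k * c\<^sup>2)"
    unfolding r_def by (rule extremal_test_vector[OF k0(1)])
  then have "real k * c * (4 - c * (r - 2)) \<le> 2 * (r - 1) + 2 * c\<^sup>2"
    by (simp add: algebra_simps power2_eq_square)
  then have "real k * c * 2 \<le> 2 * (r - 1) + 2 * c\<^sup>2" unfolding c(3) by simp
  then have "real k * c * 2 * (r - 2) \<le> (2 * (r - 1) + 2 * c\<^sup>2) * (r - 2)"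
    using r10 by (intro mult_right_mono) auto
  moreover have "real k * c * 2 * (r - 2) = 2 * real k * (c * (r - 2))"
    "(2 * (r - 1) + 2 * c\<^sup>2) * (r - 2) = 2 * ((r - 1) * (r - 2)) + 2 * c * (c * (r - 2))"
    by (simp_all add: algebra_simps power2_eq_square)
  ultimately have "4 * real k \<le> 2 * ((r - 1) * (r - 2)) + 4 * c" unfolding c(3) by simp
  then show "r\<^sup>2 - 3 * r \<ge> 2 * real k - 5 / 2" using c(2) by (simp add: algebra_simps power2_eq_square)
qed

section \<open>Comparison with the extremal graph\<close>

text \<open>
  \<open>r\<close> is the spectral radius, \<open>a\<close> and \<open>t\<close> are the two largest entries of the Perron vector on the
  \<open>m\<close> vertices other than the apex, and \<open>d\<close> and \<open>e\<close> are the degrees of their vertices there.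
\<close>

lemma no_second_heavy_vertex:
  fixes a t d e m r :: real
  assumes r: "r \<ge> 11" and X: "r\<^sup>2 - 3 * r \<ge> 2 * m - 9 / 2" "m \<ge> 47"
    and range: "0 \<le> t" "t \<le> a" "a \<le> 1"
    and deg: "a * (r\<^sup>2 + 2 - d) \<le> 3 * r + d" "t * (r\<^sup>2 + 2 - e) \<le> 3 * r + e" "d + e \<le> m + 2" "d \<le> m - 1"
    and total: "r\<^sup>2 - 3 * r - m + 3 * a \<le> d * a + 2 * (m - 1 - d) * t"
  shows "2 * t \<le> a"
proof (rule ccontr)
  assume neg: "\<not> ?thesis"
  define X where "X = r\<^sup>2 - 3 * r"
  have X_ge: "X \<ge> 179 / 2" "2 * m \<le> X + 9 / 2" using X unfolding X_def by auto
  have r2: "8 * r\<^sup>2 \<le> 11 * X"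
  proof -
    have "r * 11 \<le> r * r" using r by (intro mult_left_mono) auto
    then show ?thesis by (simp add: X_def power2_eq_square)
  qed
  \<comment> \<open>A lower bound for the degree \<open>f\<close> of a vertex with entry
    \<open>s\<close>: in \<open>s * r\<^sup>2 - 3 * r\<close>, which equals
    \<open>X - (1 - s) * r\<^sup>2\<close>, the square is replaced by its bound 11X/8.\<close>
  have heavy: "X * (11 * s - 3) / 8 + 2 * s \<le> f * (1 + s)"
    if "s * (r\<^sup>2 + 2 - f) \<le> 3 * r + f" "s \<le> 1" for s f
  proof -
    have "8 * r\<^sup>2 * (1 - s) \<le> 11 * X * (1 - s)" using r2 that(2) by (intro mult_right_mono) auto
    then have "X * (11 * s - 3) + 16 * s \<le> 8 * (f * (1 + s))" using that(1) by (simp add: X_def algebra_simps)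
    then show ?thesis by linarith
  qed
  have da: "X * (11 * a - 3) / 8 + 2 * a \<le> d * (1 + a)" using heavy deg(1) range by blast
  have et: "X * (11 * t - 3) / 8 + 2 * t \<le> e * (1 + t)" using heavy deg(2) range by auto
  show False
  \<comment> \<open>For moderate \<open>a\<close> the total weight is too small; for large
    \<open>a\<close> also \<open>t\<close> exceeds 41/100, and the two degrees are too large. The
    threshold is a convenient value at which both estimates close.\<close>
  proof (cases "a \<le> 82 / 100")
    case True
    have "2 * (m - 1 - d) * t \<le> 2 * (m - 1 - d) * a" using range deg(4) by (intro mult_left_mono) auto
    then have "X - m \<le> a * (2 * m) - a * (5 + d)" using total by (simp add: X_def algebra_simps)
    moreover have "a * (2 * m) \<le> a * (X + 9 / 2)" using X_ge range by (intro mult_left_mono) auto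
    ultimately have "4 * (a * d) \<le> 4 * a * X - 2 * a - 2 * X + 9" using X_ge by (simp add: algebra_simps)
    then have "4 * (a * d) * (1 + a) \<le> (4 * a * X - 2 * a - 2 * X + 9) * (1 + a)" using range by (intro mult_right_mono) auto
    moreover have "a * (X * (11 * a - 3) + 16 * a) \<le> a * (8 * (d * (1 + a)))" using da range by (intro mult_left_mono) auto
    ultimately have "X * ((1 - a) * (4 - 3 * a)) \<le> 18 + 14 * a - 20 * a\<^sup>2"
      by (simp add: algebra_simps power2_eq_square)
    moreover have "179 / 2 * ((1 - a) * (4 - 3 * a)) \<le> X * ((1 - a) * (4 - 3 * a))"
      using X_ge(1) range by (intro mult_right_mono mult_nonneg_nonneg) auto
    ultimately have "179 * ((1 - a) * (4 - 3 * a)) \<le> 36 + 28 * a - 40 * a\<^sup>2" by linarith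
    \<comment> \<open>A suitable multiple of this product absorbs the quadratic term and leaves an
      inequality linear in \<open>a\<close>.\<close>
    moreover have "0 \<le> (82 - 100 * a) * (1 - a)" using True range by (intro mult_nonneg_nonneg) auto
    ultimately show False using True by (simp add: algebra_simps power2_eq_square)
  next
    case False
    \<comment> \<open>Equivalent to \<open>heavy\<close> with the entry moved into a single
      denominator \<open>1 + s\<close>, which can be replaced by its lower bound \<open>b\<close>.
      The values used are 1 + 82/100 and 1 + 41/100.\<close>
    have lower: "11 * X + 16 - 8 * f \<le> (14 * X + 16) / b"
      if "X * (11 * s - 3) / 8 + 2 * s \<le> f * (1 + s)" "1 + s \<ge> b" "b > 0" for f s b
    proof (cases "11 * X + 16 - 8 * f \<ge> 0")
      case True
      have "X * (11 * s - 3) + 16 * s \<le> 8 * (f * (1 + s))" using that(1) by linarith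
      then have "(11 * X + 16 - 8 * f) * (1 + s) \<le> 14 * X + 16" by (simp add: algebra_simps)
      moreover have "(11 * X + 16 - 8 * f) * b \<le> (11 * X + 16 - 8 * f) * (1 + s)"
        using that True by (intro mult_left_mono) auto
      ultimately show ?thesis using that(3) by (simp add: pos_le_divide_eq)
    next
      case False
      moreover have "(14 * X + 16) / b \<ge> 0" using X_ge(1) that(3) by simp
      ultimately show ?thesis by linarith
    qed
    have "11 * X + 16 - 8 * d \<le> (14 * X + 16) / (182 / 100)"
      using False by (intro lower[OF da]) auto
    moreover have "11 * X + 16 - 8 * e \<le> (14 * X + 16) / (141 / 100)"
      using False neg by (intro lower[OF et]) auto
    ultimately show False using deg(3) X_ge by simp
  qed
qed

text \<open>
  Each edge meeting \<open>B\<close> is charged to its end that is removed first, which is charged at most twice;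
  both sides are doubled because edges inside \<open>B\<close> occur in both directions.
\<close>

lemma two_degenerate_sum:
  fixes f :: "'a \<Rightarrow> 'a \<Rightarrow> real"
  assumes "finite B" "finite A" "A \<inter> B = {}"
    and N: "\<And>w z. z \<in> N w \<Longrightarrow> w \<in> N z" "\<And>w. w \<notin> N w"
    and degen: "\<And>B'. B' \<subseteq> B \<Longrightarrow> B' \<noteq> {} \<Longrightarrow> \<exists>w\<in>B'. card (N w \<inter> (A \<union> B')) \<le> 2"
    and f: "\<And>w z. f w z = f z w" "\<And>w z. w \<in> B \<Longrightarrow> z \<in> A \<union> B \<Longrightarrow> f w z \<le> g w"
    and g: "\<And>w. w \<in> B \<Longrightarrow> 0 \<le> g w"
  shows "2 * (\<Sum>w\<in>B. \<Sum>z\<in>N w \<inter> A. f w z) + (\<Sum>w\<in>B. \<Sum>z\<in>N w \<inter> B. f w z) \<le> 4 * (\<Sum>w\<in>B. g w)"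
  using assms(1,3) degen f(2) g
proof (induction "card B" arbitrary: B)
  case 0
  then show ?case by simp
next
  case (Suc n)
  then have "B \<noteq> {}" by auto
  then obtain w where w: "w \<in> B" "card (N w \<inter> (A \<union> B)) \<le> 2" using Suc.prems(3)[of B] by blast
  define C where "C = B - {w}"
  have C: "finite C" "w \<notin> C" "B = insert w C" "n = card C" "C \<subseteq> B"
    using Suc.hyps(2) Suc.prems(1) w(1) by (auto simp: C_def)
  have IH: "2 * (\<Sum>w\<in>C. \<Sum>z\<in>N w \<inter> A. f w z) + (\<Sum>w\<in>C. \<Sum>z\<in>N w \<inter> C. f w z) \<le> 4 * (\<Sum>w\<in>C. g w)"
    by (rule Suc.hyps(1)[OF C(4,1)]) (use Suc.prems C in auto)
  have Nw: "N w \<inter> B = N w \<inter> C" using C(3) N(2) by auto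
  have "(\<Sum>z\<in>N y \<inter> B. f y z) = (\<Sum>z\<in>N y \<inter> C. f y z) + (if y \<in> N w then f w y else 0)" if "y \<in> C" for y
  proof (cases "y \<in> N w")
    case True
    then have "N y \<inter> B = insert w (N y \<inter> C)" using C(3) N(1) by auto
    then show ?thesis using True C f(1)[of y w] by simp
  next
    case False
    then have "N y \<inter> B = N y \<inter> C" using C(3) N(1) by auto
    then show ?thesis using False by simp
  qed
  then have "(\<Sum>y\<in>C. \<Sum>z\<in>N y \<inter> B. f y z) = (\<Sum>y\<in>C. \<Sum>z\<in>N y \<inter> C. f y z) + (\<Sum>y\<in>C. if y \<in> N w then f w y else 0)"
    by (simp add: sum.distrib)
  also have "(\<Sum>y\<in>C. if y \<in> N w then f w y else 0) = (\<Sum>y\<in>N w \<inter> C. f w y)"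
    using C(1) by (subst sum.inter_restrict[symmetric]) (auto simp: Int_commute)
  \<comment> \<open>Removing \<open>w\<close> loses each edge from \<open>w\<close> to
    \<open>C\<close> in both orientations. Edges from \<open>w\<close> to \<open>A\<close> occur in
    one orientation but carry the factor 2, so both kinds weigh the same against the charge.\<close>
  finally have inner: "(\<Sum>y\<in>B. \<Sum>z\<in>N y \<inter> B. f y z) = (\<Sum>y\<in>C. \<Sum>z\<in>N y \<inter> C. f y z) + 2 * (\<Sum>z\<in>N w \<inter> C. f w z)"
    using C Nw by simp
  have "(\<Sum>z\<in>N w \<inter> A. f w z) + (\<Sum>z\<in>N w \<inter> C. f w z) = (\<Sum>z\<in>N w \<inter> (A \<union> C). f w z)"
    using C(1,5) assms(2) Suc.prems(2) by (subst sum.union_disjoint[symmetric]) (auto simp: Int_Un_distrib)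
  also have "N w \<inter> (A \<union> C) = N w \<inter> (A \<union> B)" using Nw by blast
  also have "(\<Sum>z\<in>N w \<inter> (A \<union> B). f w z) \<le> (\<Sum>z\<in>N w \<inter> (A \<union> B). g w)"
    using Suc.prems(4) w(1) by (intro sum_mono) auto
  also have "\<dots> = real (card (N w \<inter> (A \<union> B))) * g w" by simp
  also have "\<dots> \<le> 2 * g w" using w Suc.prems(5) by (intro mult_right_mono) auto
  finally show ?case unfolding inner using IH C by simp
qed

text \<open>Every arc of \<open>R\<close> is a consecutive pair of \<open>L\<close> in one of the
  two orientations. Since \<open>f\<close> is nonnegative, consecutive pairs that are not arcs, and
  coincidences among pairs, only help.\<close>

lemma sum_consecutive_le:
  fixes f :: "'a \<Rightarrow> 'a \<Rightarrow> real"
  assumes "\<And>x y. (x, y) \<in> R \<Longrightarrow> consecutive x y L \<or> consecutive y x L"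
    and f: "\<And>x y. f x y = f y x" "\<And>x y. 0 \<le> f x y"
  shows "(\<Sum>(x, y)\<in>R. f x y) \<le> 2 * (\<Sum>i<length L - 1. f (L ! i) (L ! Suc i))"
proof -
  define I where "I = {..<length L - 1}"
  let ?P = "(\<lambda>i. (L ! i, L ! Suc i)) ` I" and ?Q = "(\<lambda>i. (L ! Suc i, L ! i)) ` I"
  let ?f = "\<lambda>(x, y). f x y"
  have fin: "finite I" by (simp add: I_def)
  have "R \<subseteq> ?P \<union> ?Q"
  proof
    fix e assume e: "e \<in> R"
    obtain x y where xy: "e = (x, y)" by (cases e)
    from assms(1)[OF e[unfolded xy]] show "e \<in> ?P \<union> ?Q"
    proof
      assume "consecutive x y L"
      then obtain i where "Suc i < length L" "x = L ! i" "y = L ! Suc i" using consecutive_nth by metis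
      then show ?thesis unfolding xy I_def by (intro UnI1 image_eqI[of _ _ i]) auto
    next
      assume "consecutive y x L"
      then obtain i where "Suc i < length L" "y = L ! i" "x = L ! Suc i" using consecutive_nth by metis
      then show ?thesis unfolding xy I_def by (intro UnI2 image_eqI[of _ _ i]) auto
    qed
  qed
  then have "sum ?f R \<le> sum ?f (?P \<union> ?Q)"
    using fin f(2) by (intro sum_mono2) auto
  also have "\<dots> \<le> sum ?f ?P + sum ?f ?Q"
    using sum.union_inter[of ?P ?Q ?f] fin f(2) sum_nonneg[of "?P \<inter> ?Q" ?f] by (auto simp: case_prod_unfold)
  also have "sum ?f ?P \<le> (\<Sum>i\<in>I. f (L ! i) (L ! Suc i))"
    using sum_image_le[OF fin, of ?f "\<lambda>i. (L ! i, L ! Suc i)"] f(2) by (simp add: o_def)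
  also have "sum ?f ?Q \<le> (\<Sum>i\<in>I. f (L ! i) (L ! Suc i))"
    using sum_image_le[OF fin, of ?f "\<lambda>i. (L ! Suc i, L ! i)"] f by (simp add: o_def)
  finally show ?thesis by (simp add: I_def)
qed

lemma obtain_argmax:
  fixes f :: "'a \<Rightarrow> real"
  assumes "finite S" "S \<noteq> {}"
  obtains u where "u \<in> S" "\<And>w. w \<in> S \<Longrightarrow> f w \<le> f u"
proof -
  have "Max (f ` S) \<in> f ` S" using assms by (intro Max_in) auto
  then obtain u where "u \<in> S" "Max (f ` S) = f u" by auto
  then show ?thesis using that[of u] Max_ge[of "f ` S"] assms(1) by auto
qed

sublocale apex_drawing \<subseteq> sided_graph "pverts G - {v}" E side
proof
  show "finite (pverts G - {v})" by simp
  show "E a b \<Longrightarrow> E b a" for a b by (rule E_sym)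
  show "E a b \<Longrightarrow> a \<in> pverts G - {v} \<and> b \<in> pverts G - {v} \<and> a \<noteq> b" for a b
    using E_in E_arc by simp
  show "side a b = side b a" for a b by (rule side_sym)
  show "E a b \<Longrightarrow> E x y \<Longrightarrow> x \<notin> {a, b} \<Longrightarrow> y \<notin> {a, b} \<Longrightarrow> side a b x = side a b y" for a b x y by (rule drawn_edge_same_side)
  show "E w z1 \<Longrightarrow> E w z2 \<Longrightarrow> E w z3 \<Longrightarrow> z1 \<noteq> z2 \<Longrightarrow> z1 \<noteq> z3 \<Longrightarrow> z2 \<noteq> z3 \<Longrightarrow>
      side w z1 z2 \<noteq> side w z1 z3 \<or> side w z2 z1 \<noteq> side w z2 z3 \<or> side w z3 z1 \<noteq> side w z3 z2" for w z1 z2 z3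
    by (rule drawn_star_separation)
  show "E w z \<Longrightarrow> E s y \<Longrightarrow> s \<notin> {w, z} \<Longrightarrow> t \<in> pverts G - {v} \<Longrightarrow> t \<notin> {s, y} \<Longrightarrow>
      t \<in> {w, z} \<or> side w z t \<noteq> side w z s \<Longrightarrow> t' \<in> pverts G - {v} \<Longrightarrow> t' \<notin> {s, y} \<Longrightarrow>
      t' \<in> {w, z} \<or> side w z t' \<noteq> side w z s \<Longrightarrow> side s y t = side s y t'" for w z s y t t'
    by (rule drawn_nested_sides) auto
qed

section \<open>Walk and edge sums in the graph without its apex\<close>

context sided_graph
begin

lemma N_sym: "z \<in> N w \<longleftrightarrow> w \<in> N z" using E_sym by (auto simp: N_def)

lemma not_in_N: "w \<notin> N w" using N_subset by blast

lemma neighbour_sum_swap: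
  assumes "finite A" "finite B"
  shows "(\<Sum>w\<in>A. \<Sum>z\<in>N w \<inter> B. h w z) = (\<Sum>z\<in>B. \<Sum>w\<in>N z \<inter> A. h w z :: real)"
proof -
  have "(\<Sum>w\<in>A. \<Sum>z\<in>N w \<inter> B. h w z) = (\<Sum>(w, z)\<in>Sigma A (\<lambda>w. N w \<inter> B). h w z)"
    using assms by (intro sum.Sigma) auto
  also have "\<dots> = (\<Sum>(z, w)\<in>Sigma B (\<lambda>z. N z \<inter> A). h w z)"
    using N_sym by (intro sum.reindex_bij_witness[of _ prod.swap prod.swap]) auto
  also have "\<dots> = (\<Sum>z\<in>B. \<Sum>w\<in>N z \<inter> A. h w z)"
    using assms by (intro sum.Sigma[symmetric]) auto
  finally show ?thesis .
qed

text \<open>Walks of length two from \<open>w\<close> are grouped by their end \<open>y\<close>: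
  there are \<open>card (N w \<inter> N y)\<close> of them, at most two unless
  \<open>y = w\<close>.\<close>

lemma walk_sum_le:
  assumes w: "w \<in> V" and x: "\<And>y. 0 \<le> x y"
  shows "(\<Sum>z\<in>N w. \<Sum>y\<in>N z. x y) \<le> real (card (N w)) * x w + 2 * ((\<Sum>y\<in>V. x y) - x w)"
proof -
  have "(\<Sum>z\<in>N w. \<Sum>y\<in>N z. x y) = (\<Sum>z\<in>N w. \<Sum>y\<in>V. if z \<in> N y then x y else 0)"
  proof (rule sum.cong[OF refl])
    fix z assume "z \<in> N w"
    have "N z = {y \<in> V. z \<in> N y}" using N_subset[of z] N_sym by blast
    then show "(\<Sum>y\<in>N z. x y) = (\<Sum>y\<in>V. if z \<in> N y then x y else 0)"
      using finite_V by (simp add: sum.inter_filter)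
  qed
  also have "\<dots> = (\<Sum>y\<in>V. \<Sum>z\<in>N w. if z \<in> N y then x y else 0)" by (rule sum.swap)
  also have "\<dots> = (\<Sum>y\<in>V. real (card (N w \<inter> N y)) * x y)"
    using finite_N by (intro sum.cong refl) (simp add: sum.If_cases Int_def)
  also have "\<dots> = real (card (N w)) * x w + (\<Sum>y\<in>V - {w}. real (card (N w \<inter> N y)) * x y)"
    using finite_V w by (simp add: sum.remove)
  also have "(\<Sum>y\<in>V - {w}. real (card (N w \<inter> N y)) * x y) \<le> (\<Sum>y\<in>V - {w}. 2 * x y)"
    using common_neighbours[of w] x by (intro sum_mono mult_right_mono) auto
  also have "\<dots> = 2 * ((\<Sum>y\<in>V. x y) - x w)"
    using finite_V w by (simp add: sum_distrib_left[symmetric] sum_diff1)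
  finally show ?thesis by simp
qed

text \<open>Ordered edges are split into those at \<open>u\<close>, those inside \<open>N u\<close>,
  and those meeting the rest, which \<open>two_degenerate_sum\<close> bounds. The weight
  \<open>f\<close> is kept abstract because the bound is needed for sums \<open>x w + x z\<close>
  and for products \<open>x w * x z\<close>.\<close>

lemma edge_sum_le:
  fixes f :: "'a \<Rightarrow> 'a \<Rightarrow> real" and g :: "'a \<Rightarrow> real"
  assumes u: "u \<in> V" and f: "\<And>w z. f w z = f z w"
    and g: "\<And>w. 0 \<le> g w" "\<And>w z. w \<in> V - insert u (N u) \<Longrightarrow> z \<in> V - {u} \<Longrightarrow> f w z \<le> g w"
  shows "(\<Sum>w\<in>V. \<Sum>z\<in>N w. f w z) \<le> 2 * (\<Sum>z\<in>N u. f u z) + (\<Sum>w\<in>N u. \<Sum>z\<in>N w \<inter> N u. f w z) +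
    4 * (\<Sum>w\<in>V - insert u (N u). g w)"
proof -
  define A where "A = N u"
  define B where "B = V - insert u A"
  have fin: "finite A" "finite B" using finite_V finite_N by (auto simp: A_def B_def)
  have AB: "A \<inter> B = {}" "u \<notin> A" "u \<notin> B" "V = insert u (A \<union> B)"
    using not_in_N N_subset[of u] u by (auto simp: A_def B_def)
  have sumV: "(\<Sum>w\<in>V. h w) = h u + (\<Sum>w\<in>A. h w) + (\<Sum>w\<in>B. h w)" for h :: "'a \<Rightarrow> real"
    using fin AB by (simp add: sum.union_disjoint)
  have NA: "(\<Sum>z\<in>N w. f w z) = f w u + (\<Sum>z\<in>N w \<inter> A. f w z) + (\<Sum>z\<in>N w \<inter> B. f w z)" if "w \<in> A" for w
  proof -
    have "N w = insert u ((N w \<inter> A) \<union> (N w \<inter> B))"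
      using that N_subset[of w] AB(4) N_sym[of u w] by (auto simp: A_def)
    then have "(\<Sum>z\<in>N w. f w z) = (\<Sum>z\<in>insert u ((N w \<inter> A) \<union> (N w \<inter> B)). f w z)" by simp
    also have "\<dots> = f w u + (\<Sum>z\<in>(N w \<inter> A) \<union> (N w \<inter> B). f w z)"
      using fin AB by simp
    also have "(\<Sum>z\<in>(N w \<inter> A) \<union> (N w \<inter> B). f w z) = (\<Sum>z\<in>N w \<inter> A. f w z) + (\<Sum>z\<in>N w \<inter> B. f w z)"
      using fin AB(1) by (intro sum.union_disjoint) auto
    finally show ?thesis by simp
  qed
  have NB: "(\<Sum>z\<in>N w. f w z) = (\<Sum>z\<in>N w \<inter> A. f w z) + (\<Sum>z\<in>N w \<inter> B. f w z)" if "w \<in> B" for w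
  proof -
    have "u \<notin> N w" using that N_sym[of u w] by (simp add: A_def B_def)
    then have "N w = (N w \<inter> A) \<union> (N w \<inter> B)" using N_subset[of w] AB(4) by blast
    then have "(\<Sum>z\<in>N w. f w z) = (\<Sum>z\<in>(N w \<inter> A) \<union> (N w \<inter> B). f w z)" by simp
    also have "\<dots> = (\<Sum>z\<in>N w \<inter> A. f w z) + (\<Sum>z\<in>N w \<inter> B. f w z)"
      using fin AB(1) by (intro sum.union_disjoint) auto
    finally show ?thesis .
  qed
  have cross: "(\<Sum>w\<in>A. \<Sum>z\<in>N w \<inter> B. f w z) = (\<Sum>w\<in>B. \<Sum>z\<in>N w \<inter> A. f w z)"
    by (subst neighbour_sum_swap[OF fin]) (simp add: f)
  have "2 * (\<Sum>w\<in>B. \<Sum>z\<in>N w \<inter> A. f w z) + (\<Sum>w\<in>B. \<Sum>z\<in>N w \<inter> B. f w z) \<le> 4 * (\<Sum>w\<in>B. g w)"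
  proof (rule two_degenerate_sum[OF fin(2,1) AB(1)])
    show "\<exists>w\<in>B'. card (N w \<inter> (A \<union> B')) \<le> 2" if "B' \<subseteq> B" "B' \<noteq> {}" for B'
      using outer_two_degenerate[OF u, of B'] that unfolding A_def B_def by blast
    show "f w z \<le> g w" if "w \<in> B" "z \<in> A \<union> B" for w z
      using g(2)[of w z] that AB unfolding A_def B_def by blast
  qed (use N_sym not_in_N f g in auto)
  moreover have "(\<Sum>w\<in>V. \<Sum>z\<in>N w. f w z) =
      (\<Sum>z\<in>A. f u z) + (\<Sum>w\<in>A. f w u) + (\<Sum>w\<in>A. \<Sum>z\<in>N w \<inter> A. f w z) + (\<Sum>w\<in>A. \<Sum>z\<in>N w \<inter> B. f w z) +
      (\<Sum>w\<in>B. \<Sum>z\<in>N w \<inter> A. f w z) + (\<Sum>w\<in>B. \<Sum>z\<in>N w \<inter> B. f w z)"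
    unfolding sumV using NA NB by (simp add: sum.distrib A_def)
  moreover have "(\<Sum>w\<in>A. f w u) = (\<Sum>z\<in>A. f u z)" using f by simp
  ultimately show ?thesis unfolding cross by (simp add: A_def B_def)
qed

lemma neighbourhood_list:
  "\<exists>L. distinct L \<and> set L = N u \<and> (\<forall>x\<in>N u. \<forall>y\<in>N u. E x y \<longrightarrow> consecutive x y L \<or> consecutive y x L)"
proof (rule linear_forest_list[OF finite_N])
  show "card {y \<in> N u. E x y} \<le> 2" if "x \<in> N u" for x
  proof -
    have "{y \<in> N u. E x y} = N x \<inter> N u" by (auto simp: N_def)
    moreover have "x \<noteq> u" using that not_in_N by blast
    ultimately show ?thesis using common_neighbours[of x u] by simp
  qed
  show "\<exists>c\<in>T. card {y \<in> T. E c y} \<le> 1" if "T \<subseteq> N u" "T \<noteq> {}" for T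
  proof -
    have "{y \<in> T. E c y} = N c \<inter> T" for c by (auto simp: N_def)
    then show ?thesis using neighbourhood_one_degenerate[OF that] by simp
  qed
qed (use E_sym E_in in blast)+

end

section \<open>Moving the eigenvector to the extremal graph\<close>

lemma (in apex_drawing) spectral_radius_le:
  assumes n: "card (pverts G) = k + 2" and k: "k \<ge> 46"
  shows "graph_spectral_radius G \<le> graph_spectral_radius (extremal_graph k)"
proof (rule ccontr)
  define \<rho> where "\<rho> = graph_spectral_radius G"
  define r where "r = graph_spectral_radius (extremal_graph k)"
  assume "\<not> ?thesis"
  then have less: "r < \<rho>" by (simp add: \<rho>_def r_def)
  have r: "r \<ge> 10" "r\<^sup>2 - 3 * r \<ge> 2 * real k - 5 / 2" using extremal_lower_bound[OF k] by (simp_all add: r_def)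
  define V where "V = pverts G - {v}"
  define m where "m = real k + 1"
  have finV: "finite V" by (simp add: V_def)
  have cardV: "card V = k + 1" using n apex_in by (simp add: V_def)
  have R: "parcs G \<subseteq> pverts G \<times> pverts G" "sym (parcs G)" "irrefl (parcs G)"
    using arc_ends arcs_symmetric by (auto simp: sym_def irrefl_def)
  obtain x' where x': "\<And>w. 0 \<le> x' w" "\<exists>w\<in>pverts G. x' w \<noteq> 0"
    "\<And>a. a \<in> pverts G \<Longrightarrow> (\<Sum>b\<in>parcs G `` {a}. x' b) = \<rho> * x' a"
    using graph_spectral_radius_eigenvector(1)[OF _ _ R] apex_in unfolding \<rho>_def
    by (metis empty_iff pair_finite_verts)
  have nb_v: "parcs G `` {v} = V" using apex_edge arc_ends by (auto simp: V_def)
  have nb: "parcs G `` {w} = insert v (N w)" if "w \<in> V" for w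
    using that apex_edge arcs_symmetric by (auto simp: V_def N_def E_def)
  have vN: "v \<notin> N w" for w using N_subset by auto
  \<comment> \<open>The apex is adjacent to all of \<open>V\<close>, so an entry 0 at
    \<open>v\<close> makes a sum of nonnegative entries vanish and the eigenvector would be
    0.\<close>
  have xv: "x' v > 0"
  proof (rule ccontr)
    assume "\<not> ?thesis"
    then have x0: "x' v = 0" using x'(1)[of v] by simp
    then have "(\<Sum>b\<in>V. x' b) = 0" using x'(3)[OF apex_in] nb_v by simp
    then have "x' b = 0" if "b \<in> V" for b using that finV x'(1) by (simp add: sum_nonneg_eq_0_iff)
    then show False using x0 x'(2) by (auto simp: V_def)
  qed
  define x where "x = (\<lambda>w. x' w / x' v)"
  have x: "0 \<le> x w" for w using x'(1) by (simp add: x_def)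
  have x1: "x v = 1" using xv by (simp add: x_def)
  have eig: "(\<Sum>b\<in>parcs G `` {a}. x b) = \<rho> * x a" if "a \<in> pverts G" for a
    using x'(3)[OF that] by (simp add: x_def flip: sum_divide_distrib)
  have sumV: "(\<Sum>w\<in>V. x w) = \<rho>" using eig[OF apex_in] x1 by (simp add: nb_v)
  have eigV: "\<rho> * x w = 1 + (\<Sum>z\<in>N w. x z)" if "w \<in> V" for w
    using eig[of w] that nb[OF that] vN finite_N x1 by (simp add: V_def)
  have "V \<noteq> {}" using cardV by auto
  then obtain u where u: "u \<in> V" "\<And>w. w \<in> V \<Longrightarrow> x w \<le> x u"
    using obtain_argmax[OF finV, of x] by blast
  have "card (V - {u}) = k" using cardV u(1) finV by simp
  then have "V - {u} \<noteq> {}" using k by (metis card.empty not_numeral_le_zero)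
  then obtain y where y: "y \<in> V - {u}" "\<And>w. w \<in> V - {u} \<Longrightarrow> x w \<le> x y"
    using obtain_argmax[of "V - {u}" x] finV by blast
  define a where "a = x u"
  define t where "t = x y"
  define A where "A = N u"
  define B where "B = V - insert u A"
  have uV: "u \<in> pverts G - {v}" and yV: "y \<in> pverts G - {v}" "y \<noteq> u" using u y by (auto simp: V_def)
  have AV: "A \<subseteq> V - {u}" using N_subset[of u] by (auto simp: A_def V_def)
  have finA: "finite A" using finite_N by (simp add: A_def)
  have sumAB: "(\<Sum>w\<in>V - {u}. h w) = (\<Sum>w\<in>A. h w) + (\<Sum>w\<in>B. h w)" for h :: "'a \<Rightarrow> real"
  proof -
    have "V - {u} = A \<union> B" "A \<inter> B = {}" using AV by (auto simp: B_def)
    then show ?thesis using finV finA by (simp add: sum.union_disjoint B_def)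
  qed
  have sumVu: "(\<Sum>w\<in>V - {u}. x w) = \<rho> - a" using sumV u(1) finV by (simp add: sum_diff1 a_def)
  have cardB: "real (card B) = m - 1 - real (card A)"
  proof -
    have "card A + card B = k" using sumAB[of "\<lambda>_. 1"] \<open>card (V - {u}) = k\<close> by simp
    then show ?thesis by (simp add: m_def)
  qed
  have rho_r: "\<rho>\<^sup>2 - 3 * \<rho> \<ge> r\<^sup>2 - 3 * r"
  proof -
    have "0 \<le> (\<rho> - r) * (\<rho> + r - 3)" using less r by (intro mult_nonneg_nonneg) auto
    then show ?thesis by (simp add: algebra_simps power2_eq_square)
  qed
  have rho: "\<rho> \<ge> 11"
  proof (rule ccontr)
    assume "\<not> ?thesis"
    \<comment> \<open>This is where \<open>k \<ge> 46\<close> enters: it is the least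
      \<open>k\<close> for which 2k - 5/2 exceeds 88.\<close>
    then have "\<rho> * (\<rho> - 3) \<le> 11 * 8" using less r by (intro mult_mono) auto
    then show False using rho_r r(2) k by (simp add: algebra_simps power2_eq_square)
  qed
  have t: "0 \<le> t" "t \<le> a" using x u(2) y(1) by (auto simp: t_def a_def)
  have a1: "a \<le> 1"
  proof -
    have "(\<Sum>z\<in>A. x z) \<le> (\<Sum>z\<in>V - {u}. x z)" using AV finV x by (intro sum_mono2) auto
    then have "\<rho> * a \<le> 1 + \<rho> - a" using eigV[OF u(1)] sumVu by (simp add: A_def a_def)
    then have "(\<rho> + 1) * a \<le> (\<rho> + 1) * 1" by (simp add: algebra_simps)
    then show ?thesis using rho mult_le_cancel_left_pos[of "\<rho> + 1" a 1] by simp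
  qed
  \<comment> \<open>The eigenvalue equation is applied twice at \<open>w\<close>;
    \<open>walk_sum_le\<close> bounds the resulting walks, with total weight \<rho> on
    \<open>V\<close>.\<close>
  have degree: "x w * (\<rho>\<^sup>2 + 2 - real (card (N w))) \<le> 3 * \<rho> + real (card (N w))" if "w \<in> V" for w
  proof -
    have wV: "w \<in> pverts G - {v}" using that by (simp add: V_def)
    have NV: "z \<in> V" if "z \<in> N w" for z using that N_subset[of w] by (auto simp: V_def)
    have "\<rho>\<^sup>2 * x w = \<rho> * (\<rho> * x w)" by (simp add: power2_eq_square)
    also have "\<dots> = \<rho> + (\<Sum>z\<in>N w. \<rho> * x z)" by (simp add: eigV[OF that] algebra_simps sum_distrib_left)
    also have "(\<Sum>z\<in>N w. \<rho> * x z) = (\<Sum>z\<in>N w. 1 + (\<Sum>y\<in>N z. x y))" using eigV NV by (intro sum.cong) auto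
    also have "\<dots> = real (card (N w)) + (\<Sum>z\<in>N w. \<Sum>y\<in>N z. x y)" by (simp add: sum.distrib)
    finally show ?thesis using walk_sum_le[OF wV, of x] x sumV unfolding V_def by (simp add: algebra_simps)
  qed
  have degrees: "real (card A) + real (card (N y)) \<le> m + 2"
  proof -
    have "card (A \<union> N y) \<le> card V"
      using N_subset[of u] N_subset[of y] finV by (intro card_mono) (auto simp: A_def V_def)
    then have "card A + card (N y) \<le> k + 1 + 2"
      using card_Un_Int[OF finA finite_N[of y]] common_neighbours[of u y] yV(2) cardV by (simp add: A_def)
    then show ?thesis by (simp add: m_def)
  qed
  \<comment> \<open>The equations are summed over \<open>V\<close> and symmetrized to weights
    \<open>x w + x z\<close> so that \<open>edge_sum_le\<close> applies. Entries of \<open>A\<close>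
    then count three times and those of \<open>B\<close> twice; both are estimated by three times
    the weight \<rho> - a of \<open>V - {u}\<close>.\<close>
  have total: "\<rho>\<^sup>2 - 3 * \<rho> - m + 3 * a \<le> real (card A) * a + 2 * (m - 1 - real (card A)) * t"
  proof -
    have "\<rho>\<^sup>2 = (\<Sum>w\<in>V. \<rho> * x w)" using sumV by (simp add: power2_eq_square flip: sum_distrib_left)
    also have "\<dots> = (\<Sum>w\<in>V. 1 + (\<Sum>z\<in>N w. x z))" using eigV by (intro sum.cong) auto
    also have "\<dots> = m + (\<Sum>w\<in>V. \<Sum>z\<in>N w. x z)" using cardV by (simp add: sum.distrib m_def)
    finally have T: "\<rho>\<^sup>2 = m + (\<Sum>w\<in>V. \<Sum>z\<in>N w. x z)" .
    have swap: "(\<Sum>w\<in>V. \<Sum>z\<in>N w. x w) = (\<Sum>w\<in>V. \<Sum>z\<in>N w. x z)"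
    proof -
      have "N w \<inter> V = N w" for w using N_subset[of w] by (auto simp: V_def)
      then show ?thesis using neighbour_sum_swap[OF finV finV, of "\<lambda>w z. x w"] by simp
    qed
    have "(\<Sum>w\<in>V. \<Sum>z\<in>N w. x w + x z) \<le> 2 * (\<Sum>z\<in>A. x u + x z) + (\<Sum>w\<in>A. \<Sum>z\<in>N w \<inter> A. x w + x z) +
        4 * (\<Sum>w\<in>B. x w + t)"
      unfolding A_def B_def V_def
    proof (rule edge_sum_le[OF uV])
      show "x w + x z \<le> x w + t" if "z \<in> pverts G - {v} - {u}" for w z
        using y(2)[of z] that by (simp add: t_def V_def)
    qed (use x t in \<open>auto simp: add.commute\<close>)
    also have "(\<Sum>z\<in>A. x u + x z) = real (card A) * a + (\<Sum>z\<in>A. x z)" by (simp add: sum.distrib a_def)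
    also have "(\<Sum>w\<in>A. \<Sum>z\<in>N w \<inter> A. x w + x z) = 2 * (\<Sum>w\<in>A. real (card (N w \<inter> A)) * x w)"
    proof -
      have "(\<Sum>w\<in>A. \<Sum>z\<in>N w \<inter> A. x z) = (\<Sum>z\<in>A. \<Sum>w\<in>N z \<inter> A. x z)"
        by (rule neighbour_sum_swap[OF finA finA])
      then show ?thesis by (simp add: sum.distrib)
    qed
    also have "(\<Sum>w\<in>A. real (card (N w \<inter> A)) * x w) \<le> (\<Sum>w\<in>A. 2 * x w)"
    proof (intro sum_mono mult_right_mono x)
      fix w assume "w \<in> A"
      then have "w \<noteq> u" using AV by blast
      then show "real (card (N w \<inter> A)) \<le> 2" using common_neighbours[of w u] by (simp add: A_def)
    qed
    also have "(\<Sum>w\<in>A. 2 * x w) = 2 * (\<Sum>w\<in>A. x w)" by (simp add: sum_distrib_left)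
    also have "(\<Sum>w\<in>B. x w + t) = (\<Sum>w\<in>B. x w) + (m - 1 - real (card A)) * t"
      by (simp add: sum.distrib cardB)
    finally have "2 * (\<Sum>w\<in>V. \<Sum>z\<in>N w. x z) \<le> 2 * (real (card A) * a + (\<Sum>z\<in>A. x z)) + 4 * (\<Sum>w\<in>A. x w) +
        4 * ((\<Sum>w\<in>B. x w) + (m - 1 - real (card A)) * t)"
      using swap by (simp add: sum.distrib)
    moreover have "(\<Sum>w\<in>B. x w) = \<rho> - a - (\<Sum>w\<in>A. x w)" using sumAB[of x] sumVu by simp
    moreover have "(\<Sum>w\<in>A. x w) \<le> \<rho> - a" using sumAB[of x] sumVu sum_nonneg[of B x] x by simp
    ultimately show ?thesis using T by (simp add: algebra_simps)
  qed
  have ta: "2 * t \<le> a"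
  proof (rule no_second_heavy_vertex[OF rho _ _ t a1 _ _ degrees _ total])
    show "2 * m - 9 / 2 \<le> \<rho>\<^sup>2 - 3 * \<rho>" using rho_r r(2) by (simp add: m_def)
    show "47 \<le> m" using k by (simp add: m_def)
    show "a * (\<rho>\<^sup>2 + 2 - real (card A)) \<le> 3 * \<rho> + real (card A)" using degree[OF u(1)] by (simp add: a_def A_def)
    show "t * (\<rho>\<^sup>2 + 2 - real (card (N y))) \<le> 3 * \<rho> + real (card (N y))" using degree[of y] y(1) by (simp add: t_def)
    show "real (card A) \<le> m - 1" using cardB of_nat_0_le_iff[of "card B", where 'a = real] by linarith
  qed
  obtain LA where LA: "distinct LA" "set LA = A" "\<And>w z. w \<in> A \<Longrightarrow> z \<in> A \<Longrightarrow> E w z \<Longrightarrow> consecutive w z LA \<or> consecutive z w LA"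
    using neighbourhood_list[of u] unfolding A_def by blast
  have "finite B" using finV by (simp add: B_def)
  then obtain LB where LB: "distinct LB" "set LB = B" using finite_distinct_list by blast
  \<comment> \<open>The order of \<open>LB\<close> is irrelevant: only edges inside \<open>A\<close>
    must become path edges, and additional consecutive pairs contribute nonnegative
    products.\<close>
  define L where "L = LA @ LB"
  have L: "distinct L" "set L = V - {u}" using LA LB AV by (auto simp: L_def B_def)
  have lenL: "length L = k" using L \<open>card (V - {u}) = k\<close> by (metis distinct_card)
  have sumL: "(\<Sum>i<k. h (L ! i)) = (\<Sum>w\<in>V - {u}. h w)" for h :: "'a \<Rightarrow> real"
    using sum.reindex_bij_betw[OF bij_betw_nth[OF L(1)], of "{..<k}" "V - {u}" h] L(2) lenL by simp
  define P where "P = (\<Sum>i<k - 1. x (L ! i) * x (L ! Suc i))"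
  have forest: "(\<Sum>w\<in>A. \<Sum>z\<in>N w \<inter> A. x w * x z) \<le> 2 * P"
  proof -
    have "(\<Sum>w\<in>A. \<Sum>z\<in>N w \<inter> A. x w * x z) = (\<Sum>(w, z)\<in>Sigma A (\<lambda>w. N w \<inter> A). x w * x z)"
      using finA by (intro sum.Sigma) auto
    also have "\<dots> \<le> 2 * (\<Sum>i<length L - 1. x (L ! i) * x (L ! Suc i))"
    proof (rule sum_consecutive_le)
      show "consecutive w z L \<or> consecutive z w L" if "(w, z) \<in> Sigma A (\<lambda>w. N w \<inter> A)" for w z
        using LA(3)[of w z] that by (auto simp: L_def consecutive_append N_def)
    qed (use x in \<open>auto simp: mult.commute\<close>)
    finally show ?thesis by (simp add: P_def lenL)
  qed
  define S where "S = (\<Sum>w\<in>pverts G. (x w)\<^sup>2)"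
  have S: "S = 1 + a\<^sup>2 + (\<Sum>w\<in>V - {u}. (x w)\<^sup>2)"
    using apex_in u(1) x1 by (simp add: S_def V_def sum.remove[of _ v] sum.remove[of _ u] a_def)
  have "\<rho> * S = (\<Sum>w\<in>pverts G. x w * (\<Sum>z\<in>parcs G `` {w}. x z))"
    unfolding S_def sum_distrib_left[of \<rho>] by (intro sum.cong) (auto simp: eig power2_eq_square)
  also have "\<dots> = \<rho> + (\<Sum>w\<in>V. x w * (\<Sum>z\<in>parcs G `` {w}. x z))"
    using apex_in x1 by (simp add: sum.remove[of _ v] V_def[symmetric] nb_v sumV)
  also have "(\<Sum>w\<in>V. x w * (\<Sum>z\<in>parcs G `` {w}. x z)) = (\<Sum>w\<in>V. x w + (\<Sum>z\<in>N w. x w * x z))"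
    by (intro sum.cong refl) (simp add: nb vN finite_N x1 algebra_simps sum_distrib_left)
  also have "\<dots> = \<rho> + (\<Sum>w\<in>V. \<Sum>z\<in>N w. x w * x z)" by (simp add: sum.distrib sumV)
  finally have form: "\<rho> * S = 2 * \<rho> + (\<Sum>w\<in>V. \<Sum>z\<in>N w. x w * x z)" by simp
  \<comment> \<open>Now with product weights: any end \<open>z\<close> other than \<open>u\<close>
    has \<open>x z \<le> t \<le> a / 2\<close>. The charges of \<open>w\<close> in \<open>B\<close>
    thus add up to the weight of a new edge from \<open>w\<close> to \<open>u\<close>.\<close>
  have "(\<Sum>w\<in>V. \<Sum>z\<in>N w. x w * x z) \<le> 2 * (\<Sum>z\<in>A. x u * x z) + (\<Sum>w\<in>A. \<Sum>z\<in>N w \<inter> A. x w * x z) +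
      4 * (\<Sum>w\<in>B. x w * (a / 2))"
    unfolding A_def B_def V_def
  proof (rule edge_sum_le[OF uV])
    show "x w * x z \<le> x w * (a / 2)" if "z \<in> pverts G - {v} - {u}" for w z
      using y(2)[of z] that x ta by (intro mult_left_mono) (auto simp: t_def V_def)
  qed (use x t in \<open>auto simp: mult.commute\<close>)
  also have "4 * (\<Sum>w\<in>B. x w * (a / 2)) = 2 * a * (\<Sum>w\<in>B. x w)"
    unfolding sum_distrib_right[symmetric] by simp
  also have "(\<Sum>z\<in>A. x u * x z) = a * (\<Sum>w\<in>A. x w)" by (simp add: sum_distrib_left a_def)
  also have "2 * (a * (\<Sum>w\<in>A. x w)) + (\<Sum>w\<in>A. \<Sum>z\<in>N w \<inter> A. x w * x z) + 2 * a * (\<Sum>w\<in>B. x w) \<le>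
      2 * a * (\<rho> - a) + 2 * P"
    using forest unfolding sumVu[symmetric] sumAB by (simp add: algebra_simps)
  finally have upper: "\<rho> * S \<le> 2 * \<rho> + 2 * a * (\<rho> - a) + 2 * P" using form by simp
  \<comment> \<open>The apex is sent to \<open>Inl 0\<close>, \<open>u\<close> to
    \<open>Inl 1\<close>, and the list \<open>L\<close> to the path. The norm stays
    \<open>S\<close>, and the quadratic form becomes exactly the right-hand side of
    \<open>upper\<close>.\<close>
  define y' :: "nat + nat \<Rightarrow> real" where
    "y' = case_sum (\<lambda>h. if h = 0 then 1 else a) (\<lambda>i. x (L ! i))"
  have "quad_form (parcs (extremal_graph k)) y' \<le> r * (\<Sum>v\<in>pverts (extremal_graph k). (y' v)\<^sup>2)"
    unfolding r_def
    by (intro graph_spectral_radius_eigenvector(2) extremal_finite extremal_wf extremal_sym extremal_irrefl)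
      (simp add: extremal_verts)
  then have "2 * (a + (1 + a) * (\<rho> - a) + P) \<le> r * S"
    unfolding extremal_quad_form extremal_norm S
    using sumL[of x] sumL[of "\<lambda>w. (x w)\<^sup>2"] sumVu by (simp add: y'_def P_def)
  then have "\<rho> * S \<le> r * S" using upper by (simp add: algebra_simps)
  moreover have "S > 0" unfolding S by (intro add_pos_nonneg sum_nonneg) auto
  ultimately show False using less by (simp add: mult_le_cancel_right)
qed

text \<open>The first conjunct places the extremal graph in the class itself, so that the bound of
  the second is attained.\<close>

theorem theorem1p2:
  fixes n :: nat
  assumes "n \<ge> 48"
  shows "planar_with_dominating_vertex n (graph_join (path_graph 2) (path_graph (n - 2))) \<and>
    (\<forall>G :: 'a pair_pre_digraph. planar_with_dominating_vertex n G \<longrightarrow>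
       graph_spectral_radius G
         \<le> graph_spectral_radius (graph_join (path_graph 2) (path_graph (n - 2))))"
  unfolding extremal_graph_def[symmetric]
proof (intro conjI allI impI)
  show "planar_with_dominating_vertex n (extremal_graph (n - 2))"
    unfolding planar_with_dominating_vertex_def
    using extremal_pair_graph extremal_card[of "n - 2"] extremal_planar extremal_dominating[of "n - 2"] assms
    by (intro conjI exI[of _ "Inl 0"]) simp_all
next
  fix G :: "'a pair_pre_digraph"
  assume G: "planar_with_dominating_vertex n G"
  then obtain p c v where "plane_drawing G p c" "dominating_vertex G v"
    by (auto simp: planar_with_dominating_vertex_def planar_def)
  then interpret apex_drawing G p c v
    using G by (intro apex_drawing.intro) (simp_all add: planar_with_dominating_vertex_def)
  show "graph_spectral_radius G \<le> graph_spectral_radius (extremal_graph (n - 2))"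
    using G assms by (intro spectral_radius_le) (auto simp: planar_with_dominating_vertex_def)
qed

end
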